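(* Let $\phi(z)=\frac{az+b}{cz+d}$, with $a,b,c,d\in\mathbb{C}$ and $ad-bc\neq 0$, be a linear fractional self-map of $\mathbb{D}$ with $\phi(0)=0$. Then $C_\phi$ is 2-complex symmetric with $J$ on $H^2(\mathbb{D})$ if and only if $C_\phi$ is normal. Likewise, $C_\phi^*$ is 2-complex symmetric with $J$ on $H^2(\mathbb{D})$ if and only if $C_\phi$ is normal.
   Context: $H^2(\mathbb{D})$ is the Hardy space of analytic functions $f$ on the open unit disk $\mathbb{D}\subset\mathbb{C}$ with $\|f\|^2=\sup_{0<r<1}\frac{1}{2\pi}\int_0^{2\pi}|f(re^{i\theta})|^2d\theta<\infty$, a Hilbert space. For an analytic self-map $\phi$ of $\mathbb{D}$, the composition operator $C_\phi$ is the bounded operator on $H^2(\mathbb{D})$ given by $C_\phi f=f\circ\phi$, and $C_\phi^*$ is its Hilbert space adjoint. $J$ is the conjugation on $H^2(\mathbb{D})$ given by $(Jf)(z)=\overline{f(\bar z)}$. A bounded linear operator $T$ on $H^2(\mathbb{D})$ is said to be 2-complex symmetric with $J$ if $JT^2J-2T^*JTJ+(T^* )^2=0$ (equivalently $JT^2-2T^*JT+(T^* )^2J=0$). A linear fractional self-map of $\mathbb{D}$ is a map $z\mapsto\frac{az+b}{cz+d}$ with $ad-bc\ne0$ that is analytic on $\mathbb{D}$ and maps $\mathbb{D}$ into $\mathbb{D}$. *)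

theory Defs
  imports "HOL-Complex_Analysis.Complex_Analysis"
begin

definition circle_mean :: "(complex \<Rightarrow> complex) \<Rightarrow> real \<Rightarrow> real" where
  "circle_mean f r =
     1 / (2 * pi) * integral {0..2 * pi} (\<lambda>\<theta>. (norm (f (of_real r * exp (\<i> * of_real \<theta>))))\<^sup>2)"

text \<open>Functions on the disk are represented as total functions vanishing outside the disk, so that
  equality of elements of the Hardy space is equality in HOL.\<close>

definition hardy2 :: "(complex \<Rightarrow> complex) set" where
  "hardy2 = {f. f holomorphic_on ball 0 1 \<and> (\<forall>z. z \<notin> ball 0 1 \<longrightarrow> f z = 0) \<and>
                bdd_above (circle_mean f ` {0<..<1})}"

definition hardy_norm :: "(complex \<Rightarrow> complex) \<Rightarrow> real" where
  "hardy_norm f = sqrt (SUP r\<in>{0<..<1}. circle_mean f r)"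

text \<open>The inner product is the one inducing the norm, recovered by polarization;
  it is linear in the first argument and conjugate-linear in the second.\<close>

definition hardy_inner :: "(complex \<Rightarrow> complex) \<Rightarrow> (complex \<Rightarrow> complex) \<Rightarrow> complex" where
  "hardy_inner f g =
     1 / 4 * (\<Sum>k<4. \<i> ^ k * of_real ((hardy_norm (\<lambda>z. f z + \<i> ^ k * g z))\<^sup>2))"

text \<open>Operators on the Hardy space are functions whose values outside \<^const>\<open>hardy2\<close> are irrelevant.\<close>

definition hardy_bounded_linear ::
    "((complex \<Rightarrow> complex) \<Rightarrow> (complex \<Rightarrow> complex)) \<Rightarrow> bool" where
  "hardy_bounded_linear T \<longleftrightarrow>
     (\<forall>f\<in>hardy2. T f \<in> hardy2) \<and>
     (\<forall>f\<in>hardy2. \<forall>g\<in>hardy2. T (\<lambda>z. f z + g z) = (\<lambda>z. T f z + T g z)) \<and>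
     (\<forall>c. \<forall>f\<in>hardy2. T (\<lambda>z. c * f z) = (\<lambda>z. c * T f z)) \<and>
     (\<exists>K. \<forall>f\<in>hardy2. hardy_norm (T f) \<le> K * hardy_norm f)"

definition hardy_adjoint ::
    "((complex \<Rightarrow> complex) \<Rightarrow> (complex \<Rightarrow> complex)) \<Rightarrow> (complex \<Rightarrow> complex) \<Rightarrow> (complex \<Rightarrow> complex)" where
  "hardy_adjoint T g =
     (THE h. h \<in> hardy2 \<and> (\<forall>f\<in>hardy2. hardy_inner (T f) g = hardy_inner f h))"

definition hardy_normal :: "((complex \<Rightarrow> complex) \<Rightarrow> (complex \<Rightarrow> complex)) \<Rightarrow> bool" where
  "hardy_normal T \<longleftrightarrow> hardy_bounded_linear T \<and>
     (\<forall>f\<in>hardy2. T (hardy_adjoint T f) = hardy_adjoint T (T f))"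

definition composition_op ::
    "(complex \<Rightarrow> complex) \<Rightarrow> (complex \<Rightarrow> complex) \<Rightarrow> (complex \<Rightarrow> complex)" where
  "composition_op \<phi> f = (\<lambda>z. if z \<in> ball 0 1 then f (\<phi> z) else 0)"

definition hardy_conj :: "(complex \<Rightarrow> complex) \<Rightarrow> (complex \<Rightarrow> complex)" where
  "hardy_conj f = (\<lambda>z. cnj (f (cnj z)))"

definition two_complex_symmetric_with ::
    "((complex \<Rightarrow> complex) \<Rightarrow> (complex \<Rightarrow> complex)) \<Rightarrow>
     ((complex \<Rightarrow> complex) \<Rightarrow> (complex \<Rightarrow> complex)) \<Rightarrow> bool" where
  "two_complex_symmetric_with J T \<longleftrightarrow> hardy_bounded_linear T \<and>
     (\<forall>f\<in>hardy2. \<forall>z\<in>ball 0 1.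
        J (T (T (J f))) z - 2 * hardy_adjoint T (J (T (J f))) z
          + hardy_adjoint T (hardy_adjoint T f) z = 0)"

end

theory Submission
  imports Defs
begin

text \<open>By Parseval, the Hardy space is \<open>\<ell>\<^sup>2\<close> on Taylor coefficients. The symbol has the form
  \<open>\<phi> z = a z / (1 - c z)\<close> with \<open>\<bar>a\<bar> + \<bar>c\<bar> \<le> 1\<close> and \<open>a \<noteq> 0\<close>. If \<open>c = 0\<close>, the adjoint of the
  composition operator is composition with \<open>cnj a * z\<close>, and all three properties hold. Conversely,
  each of them, tested on the function \<open>z\<close> (an eigenvector of the adjoint), forces \<open>c = 0\<close>:
  normality gives \<open>\<bar>a\<bar>\<^sup>2 / (1 - \<bar>c\<bar>\<^sup>2) = \<bar>a\<bar>\<^sup>2\<close>, 2-complex symmetry of the operator gives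
  \<open>a\<^sup>2 / (1 - c\<^sup>2) = a\<^sup>2\<close>, and that of the adjoint gives \<open>a\<^sup>2 z - 2 a \<phi> z + \<phi> (\<phi> z) = 0\<close>,
  so that \<open>c = 0\<close> or \<open>a = 1\<close>.\<close>

subsection \<open>Taylor coefficients and Parseval's identity\<close>


text \<open>The function \<open>z\<close> is an eigenvector of the adjoint because
  \<open>\<phi> 0 = 0\<close>: by the chain rule the linear coefficient of
  \<open>f \<circ> \<phi>\<close> is \<open>deriv \<phi> 0\<close> times that of \<open>f\<close>.
  Pairing with \<open>z\<close> reads off linear coefficients, so normality and symmetry of the
  operator each become a statement about the inner product of \<open>\<phi>\<close> with itself or
  with its conjugate. The coefficients \<open>a * c ^ (n - 1)\<close> of \<open>\<phi>\<close> make
  this a geometric series, whence the quotients. The bound on |a| + |c| comes from the unimodular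
  point at which \<open>c * z\<close> is |c|; it also excludes \<open>a = 1\<close> with
  \<open>c \<noteq> 0\<close>. The analytic obstacle is that the adjoint is a definite description,
  which says nothing until a representing function exists and is unique. Existence is the Riesz
  theorem, carried out in coefficients; it presupposes that composition is bounded, which is
  Littlewood's principle and is argued with circle means.\<close>

definition taylor_coeff :: "(complex \<Rightarrow> complex) \<Rightarrow> nat \<Rightarrow> complex" where
  "taylor_coeff f n = (deriv ^^ n) f 0 / fact n"

lemma taylor_coeff_sums:
  assumes "f holomorphic_on ball 0 1" "norm z < 1"
  shows "(\<lambda>n. taylor_coeff f n * z ^ n) sums f z"
  using holomorphic_power_series[OF assms(1), of z] assms(2) by (simp add: taylor_coeff_def)

text \<open>The germ at 0 determines the coefficients, so any expansion valid on the disk yields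
  them. This is the main device for computing coefficients below.\<close>

lemma taylor_coeff_unique:
  assumes "\<And>z. norm z < 1 \<Longrightarrow> (\<lambda>n. x n * z ^ n) sums f z"
  shows "taylor_coeff f = x"
proof -
  have "eventually (\<lambda>z. z \<in> ball 0 1) (nhds (0::complex))"
    by (rule eventually_nhds_in_open) auto
  then have "eventually (\<lambda>z. (\<lambda>n. fps_nth (Abs_fps x) n * z ^ n) sums f z) (nhds 0)"
    by eventually_elim (use assms in auto)
  then have "f has_fps_expansion Abs_fps x"
    by (rule has_fps_expansionI)
  from fps_nth_fps_expansion[OF this] show ?thesis
    by (auto simp: taylor_coeff_def)
qed

lemma power_series_holomorphic_unit_ball:
  assumes "\<And>z. norm z < 1 \<Longrightarrow> (\<lambda>n. x n * z ^ n) sums f z"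
  shows "f holomorphic_on ball 0 1"
  by (rule power_series_holomorphic[where a = x]) (use assms in auto)

lemma taylor_coeff_summable_norm:
  assumes "f holomorphic_on ball 0 1" "norm z < 1"
  shows "summable (\<lambda>n. norm (taylor_coeff f n * z ^ n))"
proof (rule powser_insidea)
  \<comment> \<open>A point of the disk strictly farther out than \<open>z\<close>: convergence
    there gives absolute convergence at \<open>z\<close>.\<close>
  have "norm (of_real ((1 + norm z) / 2) :: complex) < 1"
    using assms(2) unfolding norm_of_real by auto
  then show "summable (\<lambda>n. taylor_coeff f n * of_real ((1 + norm z) / 2) ^ n)"
    using taylor_coeff_sums[OF assms(1)] sums_summable by blast
  show "norm z < norm (of_real ((1 + norm z) / 2) :: complex)"
    using assms(2) unfolding norm_of_real by auto
qed

lemma taylor_coeff_add: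
  assumes "f holomorphic_on ball 0 1" "g holomorphic_on ball 0 1"
  shows "taylor_coeff (\<lambda>z. f z + g z) n = taylor_coeff f n + taylor_coeff g n"
proof -
  have "taylor_coeff (\<lambda>z. f z + g z) = (\<lambda>n. taylor_coeff f n + taylor_coeff g n)"
    by (rule taylor_coeff_unique) (auto simp: distrib_right intro!: sums_add taylor_coeff_sums assms)
  then show ?thesis by simp
qed

lemma taylor_coeff_cmult:
  assumes "f holomorphic_on ball 0 1"
  shows "taylor_coeff (\<lambda>z. c * f z) n = c * taylor_coeff f n"
proof -
  have "taylor_coeff (\<lambda>z. c * f z) = (\<lambda>n. c * taylor_coeff f n)"
    by (rule taylor_coeff_unique) (auto simp: mult.assoc intro!: sums_mult taylor_coeff_sums assms)
  then show ?thesis by simp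
qed

lemma taylor_coeff_cong:
  assumes "f holomorphic_on ball 0 1" "\<And>z. norm z < 1 \<Longrightarrow> g z = f z"
  shows "taylor_coeff g = taylor_coeff f"
  by (rule taylor_coeff_unique) (use assms taylor_coeff_sums in auto)

lemma taylor_coeff_0: "taylor_coeff f 0 = f 0"
  by (simp add: taylor_coeff_def)

lemma has_integral_cis_period:
  assumes "k \<noteq> (0::int)"
  shows "((\<lambda>\<theta>. cis (of_int k * \<theta>)) has_integral 0) {0..2 * pi}"
proof -
  have "((\<lambda>\<theta>. cis (of_int k * \<theta>)) has_integral
      (cis (of_int k * (2 * pi)) / (\<i> * of_int k) - cis (of_int k * 0) / (\<i> * of_int k))) {0..2 * pi}"
  proof (rule fundamental_theorem_of_calculus)
    fix t :: real
    have "((\<lambda>\<theta>. exp (\<i> * of_int k * \<theta>) / (\<i> * of_int k)) has_field_derivative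
        exp (\<i> * of_int k * t)) (at (of_real t))"
      using assms by (auto intro!: derivative_eq_intros)
    from has_vector_derivative_real_field[OF this, of "{0..2 * pi}"]
    show "((\<lambda>\<theta>. cis (of_int k * \<theta>) / (\<i> * of_int k)) has_vector_derivative cis (of_int k * t))
        (at t within {0..2 * pi})"
      by (simp add: cis_conv_exp mult.assoc)
  qed auto
  moreover have "cis (of_int k * (2 * pi)) = 1"
    using cis_multiple_2pi[of "of_int k"] by (simp add: mult.commute)
  ultimately show ?thesis by simp
qed

text \<open>Finite Parseval: in the double sum for the squared modulus only the diagonal survives
  integration. The computation is done over the complex numbers, and taking real parts at the end
  returns the real integral.\<close>

lemma has_integral_norm_sq_trig_poly:
  "((\<lambda>\<theta>. (norm (\<Sum>n<N. x n * cis \<theta> ^ n))\<^sup>2) has_integral 2 * pi * (\<Sum>n<N. (norm (x n))\<^sup>2)) {0..2 * pi}"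
proof -
  have 1: "complex_of_real ((norm (\<Sum>n<N. x n * cis \<theta> ^ n))\<^sup>2) =
      (\<Sum>n<N. \<Sum>m<N. (x n * cnj (x m)) * cis (of_int (int n - int m) * \<theta>))" for \<theta>
  proof -
    have "complex_of_real ((norm (\<Sum>n<N. x n * cis \<theta> ^ n))\<^sup>2) =
        (\<Sum>n<N. \<Sum>m<N. (x n * cis \<theta> ^ n) * cnj (x m * cis \<theta> ^ m))"
      unfolding complex_norm_square cnj_sum sum_product ..
    also have "\<dots> = (\<Sum>n<N. \<Sum>m<N. (x n * cnj (x m)) * cis (of_int (int n - int m) * \<theta>))"
      by (intro sum.cong refl) (simp add: Complex.DeMoivre cis_cnj cis_mult algebra_simps)
    finally show ?thesis .
  qed
  have 2: "((\<lambda>\<theta>. cis (of_int (int n - int m) * \<theta>)) has_integral (if m = n then 2 * pi else 0)) {0..2 * pi}"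
    for n m
  proof (cases "m = n")
    case True
    then show ?thesis
      using has_integral_const_real[of "1::complex" 0 "2 * pi"] by (simp add: scaleR_conv_of_real)
  next
    case False
    then show ?thesis using has_integral_cis_period[of "int n - int m"] by simp
  qed
  have "((\<lambda>\<theta>. complex_of_real ((norm (\<Sum>n<N. x n * cis \<theta> ^ n))\<^sup>2)) has_integral
      (\<Sum>n<N. \<Sum>m<N. (x n * cnj (x m)) * of_real (if m = n then 2 * pi else 0))) {0..2 * pi}"
    unfolding 1 by (intro has_integral_sum has_integral_mult_right 2 finite_lessThan)
  also have "(\<Sum>n<N. \<Sum>m<N. (x n * cnj (x m)) * of_real (if m = n then 2 * pi else 0)) =
      complex_of_real (2 * pi * (\<Sum>n<N. (norm (x n))\<^sup>2))"
  proof -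
    have "(\<Sum>m<N. (x n * cnj (x m)) * of_real (if m = n then 2 * pi else 0)) =
        complex_of_real (2 * pi * (norm (x n))\<^sup>2)" if "n < N" for n
    proof -
      have "(\<Sum>m<N. (x n * cnj (x m)) * of_real (if m = n then 2 * pi else 0)) =
          (\<Sum>m<N. if m = n then x n * cnj (x n) * of_real (2 * pi) else 0)"
        by (intro sum.cong) auto
      also have "\<dots> = complex_of_real (2 * pi * (norm (x n))\<^sup>2)"
        using that unfolding of_real_mult complex_norm_square by simp
      finally show ?thesis .
    qed
    then show ?thesis by (simp add: sum_distrib_left)
  qed
  finally show ?thesis
    using has_integral_linear[OF _ bounded_linear_Re, unfolded o_def] by (metis (no_types, lifting) Re_complex_of_real has_integral_cong)
qed

text \<open>Parseval on a circle strictly inside the disk. Absolute convergence there dominates all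
  partial sums by one constant, so the polynomial case passes to the limit.\<close>

lemma circle_mean_sums:
  assumes f: "f holomorphic_on ball 0 1" and r: "0 < r" "r < 1"
  shows "(\<lambda>n. (norm (taylor_coeff f n))\<^sup>2 * (r\<^sup>2) ^ n) sums circle_mean f r"
proof -
  define x where "x n = taylor_coeff f n * of_real r ^ n" for n
  have sm: "summable (\<lambda>n. norm (x n))"
    unfolding x_def by (rule taylor_coeff_summable_norm) (use assms in auto)
  have eq: "(norm (f (of_real r * exp (\<i> * of_real \<theta>))))\<^sup>2 = (norm (f (of_real r * cis \<theta>)))\<^sup>2" for \<theta>
    by (simp add: cis_conv_exp)
  have "(\<lambda>N. integral {0..2 * pi} (\<lambda>\<theta>. (norm (\<Sum>n<N. x n * cis \<theta> ^ n))\<^sup>2)) \<longlonglongrightarrow>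
      integral {0..2 * pi} (\<lambda>\<theta>. (norm (f (of_real r * cis \<theta>)))\<^sup>2)"
  proof (rule dominated_convergence(2)[where h = "\<lambda>_. (\<Sum>n. norm (x n))\<^sup>2"])
    show "(\<lambda>\<theta>. (norm (\<Sum>n<N. x n * cis \<theta> ^ n))\<^sup>2) integrable_on {0..2 * pi}" for N
      using has_integral_norm_sq_trig_poly by (rule has_integral_integrable)
    show "norm ((norm (\<Sum>n<N. x n * cis \<theta> ^ n))\<^sup>2) \<le> (\<Sum>n. norm (x n))\<^sup>2" for N \<theta>
    proof -
      have "norm (\<Sum>n<N. x n * cis \<theta> ^ n) \<le> (\<Sum>n<N. norm (x n * cis \<theta> ^ n))"
        by (rule norm_sum)
      also have "\<dots> = (\<Sum>n<N. norm (x n))"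
        by (simp add: norm_mult norm_power)
      also have "\<dots> \<le> (\<Sum>n. norm (x n))"
        by (rule sum_le_suminf[OF sm]) auto
      finally show ?thesis by (simp add: power_mono)
    qed
    show "(\<lambda>N. (norm (\<Sum>n<N. x n * cis \<theta> ^ n))\<^sup>2) \<longlonglongrightarrow> (norm (f (of_real r * cis \<theta>)))\<^sup>2" for \<theta>
    proof -
      have "(\<lambda>n. x n * cis \<theta> ^ n) sums f (of_real r * cis \<theta>)"
        using taylor_coeff_sums[OF f, of "of_real r * cis \<theta>"] r
        by (simp add: x_def norm_mult power_mult_distrib mult.assoc)
      then show ?thesis unfolding sums_def by (intro tendsto_intros)
    qed
  qed auto
  then have "(\<lambda>N. 1 / (2 * pi) * (2 * pi * (\<Sum>n<N. (norm (x n))\<^sup>2))) \<longlonglongrightarrow> circle_mean f r"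
    unfolding circle_mean_def eq
    by (intro tendsto_intros) (simp add: integral_unique[OF has_integral_norm_sq_trig_poly])
  then have "(\<lambda>n. (norm (x n))\<^sup>2) sums circle_mean f r"
    by (simp add: sums_def)
  moreover have "(norm (x n))\<^sup>2 = (norm (taylor_coeff f n))\<^sup>2 * (r\<^sup>2) ^ n" for n
    using r by (simp add: x_def norm_mult norm_power power_mult_distrib mult.commute flip: power_mult)
  ultimately show ?thesis by simp
qed

lemma circle_mean_le_suminf:
  assumes "f holomorphic_on ball 0 1" "0 < r" "r < 1" "summable (\<lambda>n. (norm (taylor_coeff f n))\<^sup>2)"
  shows "circle_mean f r \<le> (\<Sum>n. (norm (taylor_coeff f n))\<^sup>2)"
proof (rule sums_le[OF _ circle_mean_sums[OF assms(1-3)] summable_sums[OF assms(4)]])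
  have "(r\<^sup>2) ^ n \<le> 1" for n
    using assms(2,3) by (intro power_le_one) auto
  then show "(norm (taylor_coeff f n))\<^sup>2 * (r\<^sup>2) ^ n \<le> (norm (taylor_coeff f n))\<^sup>2" for n
    by (intro mult_left_le) auto
qed

text \<open>For a fixed finite partial sum the limit \<open>r \<rightarrow> 1\<close> may be taken
  term by term; only then does \<open>N\<close> grow. The bound \<open>B\<close> is arbitrary so
  that it can be the supremum in the norm as well as the estimate for a composition.\<close>

lemma
  assumes f: "f holomorphic_on ball 0 1" and B: "\<And>r. 0 < r \<Longrightarrow> r < 1 \<Longrightarrow> circle_mean f r \<le> B"
  shows summable_if_circle_mean_le: "summable (\<lambda>n. (norm (taylor_coeff f n))\<^sup>2)"
    and suminf_le_if_circle_mean_le: "(\<Sum>n. (norm (taylor_coeff f n))\<^sup>2) \<le> B"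
proof -
  have *: "(\<Sum>n<N. (norm (taylor_coeff f n))\<^sup>2) \<le> B" for N
  proof (rule tendsto_upperbound)
    show "((\<lambda>r. \<Sum>n<N. (norm (taylor_coeff f n))\<^sup>2 * (r\<^sup>2) ^ n) \<longlongrightarrow> (\<Sum>n<N. (norm (taylor_coeff f n))\<^sup>2))
        (at_left (1::real))"
      by (auto intro!: tendsto_eq_intros)
    have "eventually (\<lambda>r::real. r \<in> {0<..<1}) (at_left 1)"
      using eventually_at_left_real[of 0 1] by simp
    then show "eventually (\<lambda>r. (\<Sum>n<N. (norm (taylor_coeff f n))\<^sup>2 * (r\<^sup>2) ^ n) \<le> B) (at_left (1::real))"
    proof eventually_elim
      case (elim r)
      then have s: "(\<lambda>n. (norm (taylor_coeff f n))\<^sup>2 * (r\<^sup>2) ^ n) sums circle_mean f r"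
        using circle_mean_sums[OF f] by simp
      have "(\<Sum>n<N. (norm (taylor_coeff f n))\<^sup>2 * (r\<^sup>2) ^ n) \<le> circle_mean f r"
        unfolding sums_unique[OF s] by (rule sum_le_suminf) (use s sums_summable in auto)
      then show ?case using B elim by fastforce
    qed
  qed auto
  then show "summable (\<lambda>n. (norm (taylor_coeff f n))\<^sup>2)"
    by (intro summableI_nonneg_bounded[where x = B]) auto
  then show "(\<Sum>n. (norm (taylor_coeff f n))\<^sup>2) \<le> B"
    by (rule suminf_le_const) (rule *)
qed

lemma hardy2_iff:
  "f \<in> hardy2 \<longleftrightarrow> f holomorphic_on ball 0 1 \<and> (\<forall>z. z \<notin> ball 0 1 \<longrightarrow> f z = 0) \<and>
     summable (\<lambda>n. (norm (taylor_coeff f n))\<^sup>2)"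
proof -
  have "bdd_above (circle_mean f ` {0<..<1}) \<longleftrightarrow> summable (\<lambda>n. (norm (taylor_coeff f n))\<^sup>2)"
    if "f holomorphic_on ball 0 1"
  proof
    assume "bdd_above (circle_mean f ` {0<..<1})"
    then obtain B where "\<forall>x \<in> circle_mean f ` {0<..<1}. x \<le> B"
      by (auto simp: bdd_above_def)
    then show "summable (\<lambda>n. (norm (taylor_coeff f n))\<^sup>2)"
      by (intro summable_if_circle_mean_le[OF that, of B]) auto
  qed (use circle_mean_le_suminf[OF that] in \<open>auto intro!: bdd_aboveI\<close>)
  then show ?thesis unfolding hardy2_def by auto
qed

lemma hardy2D:
  assumes "f \<in> hardy2"
  shows "f holomorphic_on ball 0 1" "z \<notin> ball 0 1 \<Longrightarrow> f z = 0"
    "summable (\<lambda>n. (norm (taylor_coeff f n))\<^sup>2)"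
  using assms unfolding hardy2_iff by auto

lemma hardy_norm_eq:
  assumes "f \<in> hardy2"
  shows "hardy_norm f = sqrt (\<Sum>n. (norm (taylor_coeff f n))\<^sup>2)"
proof -
  note f = hardy2D[OF assms]
  have "(SUP r\<in>{0<..<1}. circle_mean f r) = (\<Sum>n. (norm (taylor_coeff f n))\<^sup>2)"
  proof (rule antisym)
    show "(SUP r\<in>{0<..<1}. circle_mean f r) \<le> (\<Sum>n. (norm (taylor_coeff f n))\<^sup>2)"
      by (rule cSUP_least) (use circle_mean_le_suminf[OF f(1) _ _ f(3)] in auto)
    have "bdd_above (circle_mean f ` {0<..<1})"
      using assms by (simp add: hardy2_def)
    then show "(\<Sum>n. (norm (taylor_coeff f n))\<^sup>2) \<le> (SUP r\<in>{0<..<1}. circle_mean f r)"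
      by (intro suminf_le_if_circle_mean_le[OF f(1)] cSUP_upper) auto
  qed
  then show ?thesis unfolding hardy_norm_def by simp
qed

lemma hardy_norm_nonneg: "f \<in> hardy2 \<Longrightarrow> 0 \<le> hardy_norm f"
  by (simp add: hardy_norm_eq suminf_nonneg hardy2D(3))

lemma hardy_norm_power2:
  assumes "f \<in> hardy2"
  shows "(hardy_norm f)\<^sup>2 = (\<Sum>n. (norm (taylor_coeff f n))\<^sup>2)"
  by (simp add: assms hardy_norm_eq suminf_nonneg hardy2D(3))

lemma hardy2_eqI:
  assumes "f \<in> hardy2" "g \<in> hardy2" "\<And>n. taylor_coeff f n = taylor_coeff g n"
  shows "f = g"
proof
  fix z
  show "f z = g z"
  proof (cases "norm z < 1")
    case True
    then show ?thesis
      using taylor_coeff_sums[OF hardy2D(1)[OF assms(1)] True]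
        taylor_coeff_sums[OF hardy2D(1)[OF assms(2)] True] assms(3) sums_unique2 by auto
  next
    case False
    then show ?thesis using hardy2D(2)[of f z] hardy2D(2)[of g z] assms by simp
  qed
qed

subsection \<open>The inner product in Taylor coefficients\<close>


lemma hardy2_add:
  assumes "f \<in> hardy2" "g \<in> hardy2"
  shows "(\<lambda>z. f z + g z) \<in> hardy2"
proof -
  note f = hardy2D[OF assms(1)] and g = hardy2D[OF assms(2)]
  have le: "(norm (x + y))\<^sup>2 \<le> 2 * (norm x)\<^sup>2 + 2 * (norm y)\<^sup>2" for x y :: complex
  proof -
    have "(norm (x + y))\<^sup>2 \<le> (norm x + norm y)\<^sup>2"
      by (intro power_mono norm_triangle_ineq) auto
    also have "\<dots> \<le> 2 * (norm x)\<^sup>2 + 2 * (norm y)\<^sup>2"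
      using sum_squares_bound[of "norm x" "norm y"] by (simp add: power2_sum)
    finally show ?thesis .
  qed
  have "summable (\<lambda>n. (norm (taylor_coeff f n + taylor_coeff g n))\<^sup>2)"
    by (rule summable_comparison_test'[OF summable_add[OF summable_mult summable_mult], OF f(3) g(3)])
      (use le in simp)
  with f g show ?thesis
    by (auto simp: hardy2_iff taylor_coeff_add intro!: holomorphic_intros)
qed

lemma hardy2_cmult:
  assumes "f \<in> hardy2"
  shows "(\<lambda>z. c * f z) \<in> hardy2"
  using hardy2D[OF assms]
  by (auto simp: hardy2_iff taylor_coeff_cmult norm_mult power_mult_distrib
      intro!: holomorphic_intros summable_mult)

lemma hardy2_diff:
  assumes "f \<in> hardy2" "g \<in> hardy2"
  shows "(\<lambda>z. f z - g z) \<in> hardy2"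
  using hardy2_add[OF assms(1) hardy2_cmult[OF assms(2), of "-1"]] by simp

lemma taylor_coeff_diff:
  assumes "f holomorphic_on ball 0 1" "g holomorphic_on ball 0 1"
  shows "taylor_coeff (\<lambda>z. f z - g z) n = taylor_coeff f n - taylor_coeff g n"
  using taylor_coeff_add[of f "\<lambda>z. -1 * g z" n] taylor_coeff_cmult[of g "-1" n] assms
  by (simp add: holomorphic_intros)

lemma summable_cross:
  fixes x y :: "nat \<Rightarrow> complex"
  assumes "summable (\<lambda>n. (norm (x n))\<^sup>2)" "summable (\<lambda>n. (norm (y n))\<^sup>2)"
  shows "summable (\<lambda>n. norm (x n * cnj (y n)))"
proof (rule summable_comparison_test'[OF summable_add[OF assms]])
  show "norm (norm (x n * cnj (y n))) \<le> (norm (x n))\<^sup>2 + (norm (y n))\<^sup>2" for n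
  proof -
    have "2 * (norm (x n) * norm (y n)) \<le> (norm (x n))\<^sup>2 + (norm (y n))\<^sup>2"
      using sum_squares_bound[of "norm (x n)" "norm (y n)"] by simp
    moreover have "norm (x n) * norm (y n) \<ge> 0" by simp
    ultimately have "norm (x n) * norm (y n) \<le> (norm (x n))\<^sup>2 + (norm (y n))\<^sup>2" by linarith
    then show ?thesis by (simp add: norm_mult)
  qed
qed

lemma polarization_complex:
  fixes x y :: complex
  shows "1 / 4 * (\<Sum>k<4. \<i> ^ k * of_real ((norm (x + \<i> ^ k * y))\<^sup>2)) = x * cnj y"
  unfolding complex_norm_square by (simp add: eval_nat_numeral algebra_simps)

text \<open>The four squared norms in the polarization formula are convergent series, so
  polarization can be applied coefficient by coefficient, where it is an identity of complex
  numbers.\<close>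

lemma hardy_inner_sums:
  assumes "f \<in> hardy2" "g \<in> hardy2"
  shows "(\<lambda>n. taylor_coeff f n * cnj (taylor_coeff g n)) sums hardy_inner f g"
proof -
  note f = hardy2D[OF assms(1)] and g = hardy2D[OF assms(2)]
  have "(\<lambda>n. (norm (taylor_coeff f n + \<i> ^ k * taylor_coeff g n))\<^sup>2) sums
      (hardy_norm (\<lambda>z. f z + \<i> ^ k * g z))\<^sup>2" for k
  proof -
    have mem: "(\<lambda>z. f z + \<i> ^ k * g z) \<in> hardy2"
      by (intro hardy2_add hardy2_cmult assms)
    have "taylor_coeff (\<lambda>z. f z + \<i> ^ k * g z) n = taylor_coeff f n + \<i> ^ k * taylor_coeff g n" for n
      using f g by (simp add: taylor_coeff_add taylor_coeff_cmult holomorphic_intros)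
    then show ?thesis
      using hardy2D(3)[OF mem] hardy_norm_power2[OF mem] by (simp add: sums_iff)
  qed
  then have "(\<lambda>n. 1 / 4 * (\<Sum>k<4. \<i> ^ k * of_real ((norm (taylor_coeff f n + \<i> ^ k * taylor_coeff g n))\<^sup>2)))
      sums hardy_inner f g"
    unfolding hardy_inner_def by (intro sums_mult sums_sum sums_of_real)
  then show ?thesis by (simp only: polarization_complex)
qed

lemma hardy_inner_add_left:
  assumes "f \<in> hardy2" "g \<in> hardy2" "h \<in> hardy2"
  shows "hardy_inner (\<lambda>z. f z + g z) h = hardy_inner f h + hardy_inner g h"
proof -
  have "(\<lambda>n. taylor_coeff (\<lambda>z. f z + g z) n * cnj (taylor_coeff h n)) sums
      (hardy_inner f h + hardy_inner g h)"
    using sums_add[OF hardy_inner_sums[OF assms(1,3)] hardy_inner_sums[OF assms(2,3)]] assms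
    by (simp add: taylor_coeff_add hardy2D(1) distrib_right)
  from sums_unique2[OF hardy_inner_sums[OF hardy2_add[OF assms(1,2)] assms(3)] this] show ?thesis .
qed

lemma hardy_inner_cmult_left:
  assumes "f \<in> hardy2" "h \<in> hardy2"
  shows "hardy_inner (\<lambda>z. c * f z) h = c * hardy_inner f h"
proof -
  have "(\<lambda>n. taylor_coeff (\<lambda>z. c * f z) n * cnj (taylor_coeff h n)) sums (c * hardy_inner f h)"
    using sums_mult[OF hardy_inner_sums[OF assms], of c] assms
    by (simp add: taylor_coeff_cmult hardy2D(1) mult.assoc)
  from sums_unique2[OF hardy_inner_sums[OF hardy2_cmult[OF assms(1)] assms(2)] this] show ?thesis .
qed

lemma hardy_inner_cnj:
  assumes "f \<in> hardy2" "g \<in> hardy2"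
  shows "hardy_inner g f = cnj (hardy_inner f g)"
proof -
  have "(\<lambda>n. cnj (taylor_coeff f n * cnj (taylor_coeff g n))) sums cnj (hardy_inner f g)"
    using hardy_inner_sums[OF assms] by (simp only: sums_cnj)
  then show ?thesis
    using sums_unique2[OF hardy_inner_sums[OF assms(2,1)]] by (simp add: mult.commute)
qed

lemma hardy_cauchy_schwarz:
  assumes "f \<in> hardy2" "g \<in> hardy2"
  shows "norm (hardy_inner f g) \<le> hardy_norm f * hardy_norm g"
proof -
  note f = hardy2D[OF assms(1)] and g = hardy2D[OF assms(2)]
  let ?c = "\<lambda>n. taylor_coeff f n * cnj (taylor_coeff g n)"
  have sm: "summable (\<lambda>n. norm (?c n))"
    by (rule summable_cross[OF f(3) g(3)])
  have "(\<Sum>n<N. norm (?c n)) \<le> hardy_norm f * hardy_norm g" for N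
  proof -
    have "(\<Sum>n<N. norm (?c n))\<^sup>2 \<le>
        (\<Sum>n<N. (norm (taylor_coeff f n))\<^sup>2) * (\<Sum>n<N. (norm (taylor_coeff g n))\<^sup>2)"
      using Cauchy_Schwarz_ineq_sum[of "\<lambda>n. norm (taylor_coeff f n)" "\<lambda>n. norm (taylor_coeff g n)"]
      by (simp add: norm_mult)
    also have "\<dots> \<le> (\<Sum>n. (norm (taylor_coeff f n))\<^sup>2) * (\<Sum>n. (norm (taylor_coeff g n))\<^sup>2)"
      by (intro mult_mono sum_le_suminf f(3) g(3) suminf_nonneg sum_nonneg) auto
    also have "\<dots> = (hardy_norm f * hardy_norm g)\<^sup>2"
      using assms by (simp add: hardy_norm_power2 power_mult_distrib)
    finally show ?thesis
      by (rule power2_le_imp_le) (simp add: hardy_norm_nonneg assms)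
  qed
  then have "(\<Sum>n. norm (?c n)) \<le> hardy_norm f * hardy_norm g"
    by (rule suminf_le_const[OF sm])
  moreover have "norm (hardy_inner f g) \<le> (\<Sum>n. norm (?c n))"
    unfolding sums_unique[OF hardy_inner_sums[OF assms]] by (rule summable_norm[OF sm])
  ultimately show ?thesis by linarith
qed

section \<open>Functions with prescribed square-summable coefficients\<close>

definition power_series_fun :: "(nat \<Rightarrow> complex) \<Rightarrow> complex \<Rightarrow> complex" where
  "power_series_fun x z = (if norm z < 1 then \<Sum>n. x n * z ^ n else 0)"

text \<open>The series converges inside the disk by comparing the square-summable \<open>x\<close>
  with the square-summable sequence of powers of the point. Hence every such sequence comes from an
  element of \<open>hardy2\<close>.\<close>

lemma
  assumes "summable (\<lambda>n. (norm (x n))\<^sup>2)"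
  shows power_series_fun_in_hardy2: "power_series_fun x \<in> hardy2"
    and taylor_coeff_power_series_fun: "taylor_coeff (power_series_fun x) = x"
proof -
  have s: "(\<lambda>n. x n * z ^ n) sums power_series_fun x z" if "norm z < 1" for z
  proof -
    \<comment> \<open>\<open>cnj z\<close> appears because \<open>summable_cross\<close> conjugates
      its second sequence.\<close>
    have "summable (\<lambda>n. (norm (cnj z ^ n))\<^sup>2)"
    proof -
      have "(norm (cnj z ^ n))\<^sup>2 = ((norm z)\<^sup>2) ^ n" for n
        by (simp add: norm_power mult.commute flip: power_mult)
      then show ?thesis using that by (simp add: summable_geometric abs_square_less_1)
    qed
    from summable_cross[OF assms this] have "summable (\<lambda>n. norm (x n * z ^ n))" by simp
    then show ?thesis
      using that by (simp add: power_series_fun_def summable_norm_cancel summable_sums)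
  qed
  show c: "taylor_coeff (power_series_fun x) = x"
    by (rule taylor_coeff_unique) (rule s)
  have "power_series_fun x holomorphic_on ball 0 1"
    by (rule power_series_holomorphic_unit_ball) (rule s)
  then show "power_series_fun x \<in> hardy2"
    unfolding hardy2_iff c using assms by (auto simp: power_series_fun_def)
qed

definition trunc_fun :: "(nat \<Rightarrow> complex) \<Rightarrow> nat \<Rightarrow> complex \<Rightarrow> complex" where
  "trunc_fun x N = power_series_fun (\<lambda>n. if n < N then x n else 0)"

text \<open>The orthonormal basis vector \<open>z ^ k\<close>, set to 0 off the disk as
  \<open>hardy2\<close> demands.\<close>

definition monomial_fun :: "nat \<Rightarrow> complex \<Rightarrow> complex" where
  "monomial_fun k = power_series_fun (\<lambda>n. if n = k then 1 else 0)"

lemma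
  shows trunc_fun_in_hardy2: "trunc_fun x N \<in> hardy2"
    and taylor_coeff_trunc_fun: "taylor_coeff (trunc_fun x N) = (\<lambda>n. if n < N then x n else 0)"
proof -
  have "summable (\<lambda>n. (norm (if n < N then x n else 0))\<^sup>2)"
    by (rule summable_finite[of "{..<N}"]) auto
  from power_series_fun_in_hardy2[OF this] taylor_coeff_power_series_fun[OF this]
  show "trunc_fun x N \<in> hardy2" "taylor_coeff (trunc_fun x N) = (\<lambda>n. if n < N then x n else 0)"
    by (simp_all add: trunc_fun_def)
qed

lemma
  shows monomial_fun_in_hardy2: "monomial_fun k \<in> hardy2"
    and taylor_coeff_monomial_fun: "taylor_coeff (monomial_fun k) = (\<lambda>n. if n = k then 1 else 0)"
proof -
  have "summable (\<lambda>n. (norm (if n = k then 1 else 0 :: complex))\<^sup>2)"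
    by (rule summable_finite[of "{k}"]) auto
  from power_series_fun_in_hardy2[OF this] taylor_coeff_power_series_fun[OF this]
  show "monomial_fun k \<in> hardy2" "taylor_coeff (monomial_fun k) = (\<lambda>n. if n = k then 1 else 0)"
    by (simp_all add: monomial_fun_def)
qed

lemma monomial_fun_eq: "norm z < 1 \<Longrightarrow> monomial_fun k z = z ^ k"
  using sums_unique[OF sums_single[of k "\<lambda>n. z ^ n"]]
  unfolding monomial_fun_def power_series_fun_def
  by (simp add: if_distrib[where f = "\<lambda>x. x * _"] cong: if_cong)

lemma hardy_inner_monomial:
  assumes "f \<in> hardy2"
  shows "hardy_inner f (monomial_fun k) = taylor_coeff f k"
proof -
  have "(\<lambda>n. taylor_coeff f n * cnj (taylor_coeff (monomial_fun k) n)) sums taylor_coeff f k"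
    using sums_single[of k "taylor_coeff f"]
    by (simp add: taylor_coeff_monomial_fun if_distrib[where f = cnj] if_distrib[where f = "(*) _"] cong: if_cong)
  from sums_unique2[OF hardy_inner_sums[OF assms monomial_fun_in_hardy2] this] show ?thesis .
qed

lemma hardy_norm_trunc_power2: "(hardy_norm (trunc_fun x N))\<^sup>2 = (\<Sum>n<N. (norm (x n))\<^sup>2)"
proof -
  have "(\<lambda>n. (norm (taylor_coeff (trunc_fun x N) n))\<^sup>2) sums (\<Sum>n<N. (norm (taylor_coeff (trunc_fun x N) n))\<^sup>2)"
    by (rule sums_finite) (auto simp: taylor_coeff_trunc_fun)
  then show ?thesis
    using hardy_norm_power2[OF trunc_fun_in_hardy2, of x N] by (simp add: sums_iff taylor_coeff_trunc_fun)
qed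

text \<open>The squared norm of the remainder is the tail of a convergent series. This is the
  density of polynomials that lets a bounded operator be tested on truncations.\<close>

lemma hardy_norm_diff_trunc_tendsto:
  assumes "f \<in> hardy2"
  shows "(\<lambda>N. hardy_norm (\<lambda>z. f z - trunc_fun (taylor_coeff f) N z)) \<longlonglongrightarrow> 0"
proof -
  note f = hardy2D[OF assms]
  let ?S = "\<Sum>n. (norm (taylor_coeff f n))\<^sup>2"
  have eq: "(hardy_norm (\<lambda>z. f z - trunc_fun (taylor_coeff f) N z))\<^sup>2 = ?S - (\<Sum>n<N. (norm (taylor_coeff f n))\<^sup>2)"
    for N
  proof -
    have mem: "(\<lambda>z. f z - trunc_fun (taylor_coeff f) N z) \<in> hardy2"
      by (intro hardy2_diff assms trunc_fun_in_hardy2)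
    have "(\<lambda>n. (norm (taylor_coeff f n))\<^sup>2 - (if n < N then (norm (taylor_coeff f n))\<^sup>2 else 0)) sums
        (?S - (\<Sum>n<N. (norm (taylor_coeff f n))\<^sup>2))"
      using sums_If_finite[of "\<lambda>n. n < N" "\<lambda>n. (norm (taylor_coeff f n))\<^sup>2"]
      by (intro sums_diff summable_sums f(3)) (simp add: lessThan_def)
    moreover have "(norm (taylor_coeff (\<lambda>z. f z - trunc_fun (taylor_coeff f) N z) n))\<^sup>2 =
        (norm (taylor_coeff f n))\<^sup>2 - (if n < N then (norm (taylor_coeff f n))\<^sup>2 else 0)" for n
      using f(1) hardy2D(1)[OF trunc_fun_in_hardy2]
      by (simp add: taylor_coeff_diff taylor_coeff_trunc_fun)
    ultimately show ?thesis
      unfolding hardy_norm_power2[OF mem] by (simp add: sums_iff)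
  qed
  have "(\<lambda>N. sqrt (?S - (\<Sum>n<N. (norm (taylor_coeff f n))\<^sup>2))) \<longlonglongrightarrow> sqrt (?S - ?S)"
    by (intro tendsto_intros summable_LIMSEQ f(3))
  moreover have "hardy_norm (\<lambda>z. f z - trunc_fun (taylor_coeff f) N z) =
      sqrt (?S - (\<Sum>n<N. (norm (taylor_coeff f n))\<^sup>2))" for N
    unfolding eq[symmetric]
    by (rule real_sqrt_unique[symmetric]) (auto intro!: hardy_norm_nonneg hardy2_diff assms trunc_fun_in_hardy2)
  ultimately show ?thesis by simp
qed

subsection \<open>Adjoints and Littlewood's subordination principle\<close>


text \<open>Uniqueness comes from pairing with monomials, which recovers every coefficient of the
  candidate. As \<open>T\<close> is arbitrary, the rule also applies when \<open>T\<close> is itself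
  an adjoint.\<close>

lemma hardy_adjointI:
  assumes "h \<in> hardy2" "\<And>f. f \<in> hardy2 \<Longrightarrow> hardy_inner (T f) g = hardy_inner f h"
  shows "hardy_adjoint T g = h"
  unfolding hardy_adjoint_def
proof (rule the_equality)
  fix h' assume h': "h' \<in> hardy2 \<and> (\<forall>f\<in>hardy2. hardy_inner (T f) g = hardy_inner f h')"
  show "h' = h"
  proof (rule hardy2_eqI)
    fix n
    have "hardy_inner (monomial_fun n) h' = hardy_inner (monomial_fun n) h"
      using h' assms(2) monomial_fun_in_hardy2 by metis
    then show "taylor_coeff h' n = taylor_coeff h n"
      using h' assms(1) hardy_inner_cnj[of _ "monomial_fun n"]
      by (metis complex_cnj_cnj hardy_inner_monomial monomial_fun_in_hardy2)
  qed (use h' assms in auto)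
qed (use assms in auto)

lemma hardy_bounded_linearD:
  assumes "hardy_bounded_linear T" "f \<in> hardy2"
  shows "T f \<in> hardy2" "g \<in> hardy2 \<Longrightarrow> T (\<lambda>z. f z + g z) = (\<lambda>z. T f z + T g z)"
    "T (\<lambda>z. c * f z) = (\<lambda>z. c * T f z)"
  using assms unfolding hardy_bounded_linear_def by blast+

lemma hardy_bounded_linear_zero:
  assumes "hardy_bounded_linear T" "f \<in> hardy2"
  shows "T (\<lambda>z. 0) = (\<lambda>z. 0)"
  using hardy_bounded_linearD(3)[OF assms, of 0] by simp

lemma hardy_inner_operator_trunc:
  assumes T: "hardy_bounded_linear T" and g: "g \<in> hardy2"
  shows "hardy_inner (T (trunc_fun x N)) g = (\<Sum>n<N. x n * hardy_inner (T (monomial_fun n)) g)"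
proof (induction N)
  case 0
  have "trunc_fun x 0 = (\<lambda>z. 0)"
    by (rule ext) (simp add: trunc_fun_def power_series_fun_def)
  \<comment> \<open>The zero function is written as a multiple of \<open>g\<close>, so that
    homogeneity of the inner product gives the value 0.\<close>
  then have "T (trunc_fun x 0) = (\<lambda>z. 0 * g z)"
    using hardy_bounded_linear_zero[OF T g] by simp
  then show ?case
    using hardy_inner_cmult_left[OF g g, of 0] by simp
next
  case (Suc N)
  note mem = trunc_fun_in_hardy2[of x N] hardy2_cmult[OF monomial_fun_in_hardy2[of N], of "x N"]
  have "trunc_fun x (Suc N) = (\<lambda>z. trunc_fun x N z + x N * monomial_fun N z)"
  proof (rule hardy2_eqI)
    show "taylor_coeff (trunc_fun x (Suc N)) n =
        taylor_coeff (\<lambda>z. trunc_fun x N z + x N * monomial_fun N z) n" for n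
      using hardy2D(1)[OF mem(1)] hardy2D(1)[OF mem(2)] hardy2D(1)[OF monomial_fun_in_hardy2[of N]]
      by (auto simp: taylor_coeff_add taylor_coeff_cmult taylor_coeff_trunc_fun taylor_coeff_monomial_fun less_Suc_eq)
  qed (intro hardy2_add trunc_fun_in_hardy2 mem)+
  moreover have "T (\<lambda>z. trunc_fun x N z + x N * monomial_fun N z) =
      (\<lambda>z. T (trunc_fun x N) z + x N * T (monomial_fun N) z)"
    using hardy_bounded_linearD(2)[OF T mem] hardy_bounded_linearD(3)[OF T monomial_fun_in_hardy2] by simp
  moreover have "T (trunc_fun x N) \<in> hardy2" "T (monomial_fun N) \<in> hardy2"
    by (intro hardy_bounded_linearD(1)[OF T] trunc_fun_in_hardy2 monomial_fun_in_hardy2)+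
  ultimately show ?case
    using Suc.IH by (simp add: hardy_inner_add_left hardy_inner_cmult_left hardy2_cmult g)
qed

text \<open>Riesz representation in coordinates. The coefficients of the representing function are
  forced by its pairings with the monomials; the work lies in showing that they are
  square-summable.\<close>

lemma hardy_adjoint_exists:
  assumes T: "hardy_bounded_linear T" and g: "g \<in> hardy2"
  shows "\<exists>h\<in>hardy2. \<forall>f\<in>hardy2. hardy_inner (T f) g = hardy_inner f h"
proof -
  define x where "x n = cnj (hardy_inner (T (monomial_fun n)) g)" for n
  obtain K0 where K0: "\<And>f. f \<in> hardy2 \<Longrightarrow> hardy_norm (T f) \<le> K0 * hardy_norm f"
    using T unfolding hardy_bounded_linear_def by blast
  \<comment> \<open>The absolute value is taken because boundedness is stated without requiring
    \<open>K0\<close> to be nonnegative.\<close>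
  define K where "K = \<bar>K0\<bar> * hardy_norm g"
  note Tmem = hardy_bounded_linearD(1)[OF T]
  have bound: "norm (hardy_inner (T f) g) \<le> K * hardy_norm f" if f: "f \<in> hardy2" for f
  proof -
    have "norm (hardy_inner (T f) g) \<le> hardy_norm (T f) * hardy_norm g"
      by (rule hardy_cauchy_schwarz[OF Tmem[OF f] g])
    also have "\<dots> \<le> (\<bar>K0\<bar> * hardy_norm f) * hardy_norm g"
    proof (rule mult_right_mono)
      have "K0 * hardy_norm f \<le> \<bar>K0\<bar> * hardy_norm f"
        by (intro mult_right_mono hardy_norm_nonneg f) auto
      then show "hardy_norm (T f) \<le> \<bar>K0\<bar> * hardy_norm f"
        using K0[OF f] by linarith
    qed (rule hardy_norm_nonneg[OF g])
    finally show ?thesis by (simp add: K_def mult_ac)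
  qed
  have sx: "summable (\<lambda>n. (norm (x n))\<^sup>2)"
  proof (rule summableI_nonneg_bounded)
    fix N
    let ?s = "hardy_norm (trunc_fun x N)"
    \<comment> \<open>The functional is tested on the truncation of its own coefficient sequence. It
      returns the squared norm \<open>?s\<^sup>2\<close>, and boundedness gives
      \<open>?s\<^sup>2 \<le> K * ?s\<close>, hence the bound \<open>K\<close> uniformly in
      \<open>N\<close>.\<close>
    have "hardy_inner (T (trunc_fun x N)) g = (\<Sum>n<N. x n * cnj (x n))"
      unfolding hardy_inner_operator_trunc[OF T g] by (simp add: x_def)
    also have "\<dots> = of_real (\<Sum>n<N. (norm (x n))\<^sup>2)"
      unfolding of_real_sum complex_norm_square ..
    finally have "hardy_inner (T (trunc_fun x N)) g = of_real (?s\<^sup>2)"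
      unfolding hardy_norm_trunc_power2 .
    then have "?s\<^sup>2 \<le> K * ?s"
      using bound[OF trunc_fun_in_hardy2, of x N] by (simp add: norm_power)
    moreover have "?s \<ge> 0" by (rule hardy_norm_nonneg[OF trunc_fun_in_hardy2])
    moreover have "K \<ge> 0" unfolding K_def by (simp add: hardy_norm_nonneg g)
    ultimately have "?s \<le> K"
      by (cases "?s = 0") (auto simp: power2_eq_square)
    then have "?s\<^sup>2 \<le> K\<^sup>2" by (intro power_mono) (simp add: hardy_norm_nonneg trunc_fun_in_hardy2)+
    then show "(\<Sum>n<N. (norm (x n))\<^sup>2) \<le> K\<^sup>2" by (simp add: hardy_norm_trunc_power2)
  qed simp
  let ?h = "power_series_fun x"
  note h = power_series_fun_in_hardy2[OF sx]
  have "hardy_inner (T f) g = hardy_inner f ?h" if f: "f \<in> hardy2" for f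
  proof -
    let ?p = "trunc_fun (taylor_coeff f)"
    have "(\<lambda>N. hardy_inner (T (?p N)) g) \<longlonglongrightarrow> hardy_inner f ?h"
      using hardy_inner_sums[OF f h]
      unfolding hardy_inner_operator_trunc[OF T g] sums_def taylor_coeff_power_series_fun[OF sx]
      by (simp add: x_def)
    moreover have "(\<lambda>N. hardy_inner (T (?p N)) g) \<longlonglongrightarrow> hardy_inner (T f) g"
    \<comment> \<open>By linearity the error is the functional at the remainder of \<open>f\<close>,
      so \<open>bound\<close> controls it by the norm of that remainder.\<close>
    proof (rule LIM_zero_cancel, rule Lim_null_comparison[OF always_eventually[OF allI]])
      have "(\<lambda>N. K * hardy_norm (\<lambda>z. f z - ?p N z)) \<longlonglongrightarrow> K * 0"
        by (intro tendsto_intros hardy_norm_diff_trunc_tendsto f)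
      then show "(\<lambda>N. K * hardy_norm (\<lambda>z. f z - ?p N z)) \<longlonglongrightarrow> 0" by simp
      show "norm (hardy_inner (T (?p N)) g - hardy_inner (T f) g) \<le> K * hardy_norm (\<lambda>z. f z - ?p N z)" for N
      proof -
        have p: "?p N \<in> hardy2" and d: "(\<lambda>z. f z - ?p N z) \<in> hardy2"
          by (intro hardy2_diff f trunc_fun_in_hardy2)+
        have "T (\<lambda>z. (f z - ?p N z) + ?p N z) = (\<lambda>z. T (\<lambda>z. f z - ?p N z) z + T (?p N) z)"
          by (rule hardy_bounded_linearD(2)[OF T d p])
        then have "hardy_inner (T f) g = hardy_inner (T (\<lambda>z. f z - ?p N z)) g + hardy_inner (T (?p N)) g"
          using hardy_inner_add_left[OF Tmem[OF d] Tmem[OF p] g] by simp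
        then show ?thesis using bound[OF d] by simp
      qed
    qed
    ultimately show ?thesis by (rule LIMSEQ_unique[THEN sym])
  qed
  then show ?thesis using h by blast
qed

lemma
  assumes "hardy_bounded_linear T" "g \<in> hardy2"
  shows hardy_adjoint_in_hardy2: "hardy_adjoint T g \<in> hardy2"
    and hardy_inner_adjoint: "f \<in> hardy2 \<Longrightarrow> hardy_inner (T f) g = hardy_inner f (hardy_adjoint T g)"
proof -
  obtain h where h: "h \<in> hardy2" "\<And>f. f \<in> hardy2 \<Longrightarrow> hardy_inner (T f) g = hardy_inner f h"
    using hardy_adjoint_exists[OF assms] by blast
  then have "hardy_adjoint T g = h" by (rule hardy_adjointI)
  with h show "hardy_adjoint T g \<in> hardy2"
    "f \<in> hardy2 \<Longrightarrow> hardy_inner (T f) g = hardy_inner f (hardy_adjoint T g)"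
    by auto
qed

lemma hardy_adjoint_adjoint:
  assumes "hardy_bounded_linear T" "f \<in> hardy2"
  shows "hardy_adjoint (hardy_adjoint T) f = T f"
proof (rule hardy_adjointI)
  show mem: "T f \<in> hardy2" by (rule hardy_bounded_linearD(1)[OF assms])
  fix g assume g: "g \<in> hardy2"
  have "hardy_inner (hardy_adjoint T g) f = cnj (hardy_inner f (hardy_adjoint T g))"
    by (rule hardy_inner_cnj[OF assms(2) hardy_adjoint_in_hardy2[OF assms(1) g]])
  also have "\<dots> = cnj (hardy_inner (T f) g)"
    by (simp add: hardy_inner_adjoint[OF assms(1) g assms(2)])
  also have "\<dots> = hardy_inner g (T f)"
    by (rule hardy_inner_cnj[OF mem g, symmetric])
  finally show "hardy_inner (hardy_adjoint T g) f = hardy_inner g (T f)" .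
qed

section \<open>Littlewood's subordination principle\<close>

lemma circle_mean_mono:
  assumes "f holomorphic_on ball 0 1" "g holomorphic_on ball 0 1" "0 < r" "r < 1"
    and "\<And>z. norm z < 1 \<Longrightarrow> norm (f z) \<le> norm (g z)"
  shows "circle_mean f r \<le> circle_mean g r"
proof -
  have "(\<lambda>\<theta>. (norm (h (of_real r * exp (\<i> * of_real \<theta>))))\<^sup>2) integrable_on {0..2 * pi}"
    if "h holomorphic_on ball 0 1" for h
  proof (rule integrable_continuous_real, intro continuous_intros)
    show "continuous_on {0..2 * pi} (\<lambda>\<theta>. h (of_real r * exp (\<i> * of_real \<theta>)))"
      by (rule continuous_on_compose2[OF holomorphic_on_imp_continuous_on[OF that]])
        (use assms(3,4) in \<open>auto intro!: continuous_intros simp: norm_mult\<close>)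
  qed
  then show ?thesis
    unfolding circle_mean_def using assms
    by (intro mult_left_mono integral_le) (auto simp: norm_mult intro!: power_mono)
qed

text \<open>Pythagoras: a constant is orthogonal on every circle to a function that vanishes at
  0.\<close>

lemma circle_mean_add_const:
  assumes "g holomorphic_on ball 0 1" "g 0 = 0" "0 < r" "r < 1"
  shows "circle_mean (\<lambda>z. c + g z) r = (norm c)\<^sup>2 + circle_mean g r"
proof -
  let ?h = "\<lambda>z. c + g z"
  have h: "?h holomorphic_on ball 0 1" by (intro holomorphic_intros assms)
  have const: "taylor_coeff (\<lambda>z. c) = (\<lambda>n. if n = 0 then c else 0)"
    by (rule taylor_coeff_unique) (use sums_single[of 0 "\<lambda>n. c"] in
        \<open>simp add: if_distrib[where f = "\<lambda>x. x * _"] cong: if_cong\<close>)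
  have coeff: "taylor_coeff ?h n = (if n = 0 then c else taylor_coeff g n)" for n
    using taylor_coeff_add[of "\<lambda>z. c" g n] assms by (simp add: const taylor_coeff_0)
  have "(\<lambda>n. (if n = 0 then (norm c)\<^sup>2 else 0) + (norm (taylor_coeff g n))\<^sup>2 * (r\<^sup>2) ^ n) sums
      ((norm c)\<^sup>2 + circle_mean g r)"
    using sums_single[of 0 "\<lambda>n. (norm c)\<^sup>2"] circle_mean_sums[OF assms(1,3,4)] by (rule sums_add)
  moreover have "(if n = 0 then (norm c)\<^sup>2 else 0) + (norm (taylor_coeff g n))\<^sup>2 * (r\<^sup>2) ^ n =
      (norm (taylor_coeff ?h n))\<^sup>2 * (r\<^sup>2) ^ n" for n
    using assms(2) by (simp add: coeff taylor_coeff_0)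
  ultimately show ?thesis
    using sums_unique2[OF circle_mean_sums[OF h assms(3,4)]] by simp
qed

locale disk_self_map =
  fixes \<phi> :: "complex \<Rightarrow> complex"
  assumes holomorphic: "\<phi> holomorphic_on ball 0 1"
    and norm_less_1: "\<And>z. norm z < 1 \<Longrightarrow> norm (\<phi> z) < 1"
    and zero: "\<phi> 0 = 0"
begin

text \<open>The constant term splits off orthogonally, and \<open>\<bar>\<phi>\<bar> \<le> 1\<close> allows one to drop a factor \<open>\<phi>\<close>
  from the rest, which leaves a polynomial in \<open>\<phi>\<close> of lower degree.\<close>

lemma circle_mean_poly_compose_le:
  assumes "0 < r" "r < 1"
  shows "circle_mean (\<lambda>z. \<Sum>n<N. x n * \<phi> z ^ n) r \<le> (\<Sum>n<N. (norm (x n))\<^sup>2)"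
proof (induction N arbitrary: x)
  case 0
  then show ?case by (simp add: circle_mean_def)
next
  case (Suc N)
  let ?q = "\<lambda>z. \<Sum>n<N. x (Suc n) * \<phi> z ^ n"
  have q: "?q holomorphic_on ball 0 1"
    by (intro holomorphic_intros holomorphic)
  have "circle_mean (\<lambda>z. \<Sum>n<Suc N. x n * \<phi> z ^ n) r = circle_mean (\<lambda>z. x 0 + \<phi> z * ?q z) r"
    by (simp add: sum.lessThan_Suc_shift sum_distrib_left mult_ac del: sum.lessThan_Suc)
  also have "\<dots> = (norm (x 0))\<^sup>2 + circle_mean (\<lambda>z. \<phi> z * ?q z) r"
    by (rule circle_mean_add_const) (use assms zero in \<open>auto intro!: holomorphic_intros holomorphic\<close>)
  also have "circle_mean (\<lambda>z. \<phi> z * ?q z) r \<le> circle_mean ?q r"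
  proof (rule circle_mean_mono)
    show "norm (\<phi> z * ?q z) \<le> norm (?q z)" if "norm z < 1" for z
      using norm_less_1[OF that] by (simp add: norm_mult mult_left_le_one_le)
  qed (use assms in \<open>auto intro!: holomorphic_intros holomorphic\<close>)
  also have "circle_mean ?q r \<le> (\<Sum>n<N. (norm (x (Suc n)))\<^sup>2)"
    by (rule Suc.IH)
  finally show ?case
    by (simp add: sum.lessThan_Suc_shift del: sum.lessThan_Suc)
qed

text \<open>The Schwarz lemma keeps \<open>\<phi>\<close> of the circle of radius \<open>r\<close>
  inside the closed disk of radius \<open>r\<close>, where the series of \<open>f\<close> is
  dominated by its absolute sum. This carries the polynomial estimate over to
  \<open>f\<close>.\<close>

lemma circle_mean_compose_le:
  assumes f: "f \<in> hardy2" and r: "0 < r" "r < 1"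
  shows "circle_mean (\<lambda>z. f (\<phi> z)) r \<le> (hardy_norm f)\<^sup>2"
proof (rule LIMSEQ_le_const2)
  let ?x = "taylor_coeff f"
  let ?w = "\<lambda>\<theta>. \<phi> (of_real r * exp (\<i> * of_real \<theta>))"
  note holf = hardy2D(1)[OF f]
  have z: "norm (of_real r * exp (\<i> * of_real \<theta>)) = r" for \<theta>
    using r by (simp add: norm_mult)
  have w: "norm (?w \<theta>) \<le> r" for \<theta>
    using Schwarz_Lemma(1)[OF holomorphic zero norm_less_1, of "of_real r * exp (\<i> * of_real \<theta>)"] z[of \<theta>] r
    by simp
  have sm: "summable (\<lambda>n. norm (?x n) * r ^ n)"
    using taylor_coeff_summable_norm[OF holf, of "of_real r"] r by (simp add: norm_mult norm_power)
  have "(\<lambda>N. integral {0..2 * pi} (\<lambda>\<theta>. (norm (\<Sum>n<N. ?x n * ?w \<theta> ^ n))\<^sup>2)) \<longlonglongrightarrow>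
      integral {0..2 * pi} (\<lambda>\<theta>. (norm (f (?w \<theta>)))\<^sup>2)"
  proof (rule dominated_convergence(2)[where h = "\<lambda>_. (\<Sum>n. norm (?x n) * r ^ n)\<^sup>2"])
    have "continuous_on {0..2 * pi} ?w"
      by (rule continuous_on_compose2[OF holomorphic_on_imp_continuous_on[OF holomorphic]])
        (use r in \<open>auto intro!: continuous_intros simp: z\<close>)
    then show "(\<lambda>\<theta>. (norm (\<Sum>n<N. ?x n * ?w \<theta> ^ n))\<^sup>2) integrable_on {0..2 * pi}" for N
      by (intro integrable_continuous_real continuous_intros)
    show "norm ((norm (\<Sum>n<N. ?x n * ?w \<theta> ^ n))\<^sup>2) \<le> (\<Sum>n. norm (?x n) * r ^ n)\<^sup>2" for N \<theta>
    proof -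
      have "norm (\<Sum>n<N. ?x n * ?w \<theta> ^ n) \<le> (\<Sum>n<N. norm (?x n * ?w \<theta> ^ n))"
        by (rule norm_sum)
      also have "\<dots> \<le> (\<Sum>n<N. norm (?x n) * r ^ n)"
        unfolding norm_mult norm_power by (intro sum_mono mult_left_mono power_mono w) auto
      also have "\<dots> \<le> (\<Sum>n. norm (?x n) * r ^ n)"
        by (rule sum_le_suminf[OF sm]) (use r in auto)
      finally show ?thesis by (simp add: power_mono)
    qed
    show "(\<lambda>N. (norm (\<Sum>n<N. ?x n * ?w \<theta> ^ n))\<^sup>2) \<longlonglongrightarrow> (norm (f (?w \<theta>)))\<^sup>2" for \<theta>
      using taylor_coeff_sums[OF holf, of "?w \<theta>"] w[of \<theta>] r
      unfolding sums_def by (intro tendsto_intros) auto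
  qed auto
  then show "(\<lambda>N. circle_mean (\<lambda>z. \<Sum>n<N. ?x n * \<phi> z ^ n) r) \<longlonglongrightarrow> circle_mean (\<lambda>z. f (\<phi> z)) r"
    unfolding circle_mean_def by (intro tendsto_intros)
  have "(\<Sum>n<N. (norm (?x n))\<^sup>2) \<le> (hardy_norm f)\<^sup>2" for N
    unfolding hardy_norm_power2[OF f] by (rule sum_le_suminf) (use hardy2D(3)[OF f] in auto)
  then show "\<exists>N0. \<forall>N\<ge>N0. circle_mean (\<lambda>z. \<Sum>n<N. ?x n * \<phi> z ^ n) r \<le> (hardy_norm f)\<^sup>2"
    using circle_mean_poly_compose_le[OF r, of ?x] order_trans by blast
qed

text \<open>Because \<open>\<phi>\<close> fixes 0, composition is a contraction, so the constant is
  1.\<close>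

lemma hardy_bounded_linear_composition_op: "hardy_bounded_linear (composition_op \<phi>)"
proof -
  have *: "composition_op \<phi> f \<in> hardy2 \<and> hardy_norm (composition_op \<phi> f) \<le> hardy_norm f"
    if f: "f \<in> hardy2" for f
  proof -
    have fp: "(\<lambda>z. f (\<phi> z)) holomorphic_on ball 0 1"
    proof -
      have "\<phi> ` ball 0 1 \<subseteq> ball 0 1" using norm_less_1 by auto
      from holomorphic_on_compose_gen[OF holomorphic hardy2D(1)[OF f] this] show ?thesis
        by (simp add: o_def)
    qed
    have coeff: "taylor_coeff (composition_op \<phi> f) = taylor_coeff (\<lambda>z. f (\<phi> z))"
      by (rule taylor_coeff_cong[OF fp]) (simp add: composition_op_def)
    have hol: "composition_op \<phi> f holomorphic_on ball 0 1"
      by (rule holomorphic_transform[OF fp]) (simp add: composition_op_def)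
    have mem: "composition_op \<phi> f \<in> hardy2"
      unfolding hardy2_iff coeff using hol summable_if_circle_mean_le[OF fp circle_mean_compose_le[OF f]]
      by (simp add: composition_op_def)
    moreover have "(hardy_norm (composition_op \<phi> f))\<^sup>2 \<le> (hardy_norm f)\<^sup>2"
      unfolding hardy_norm_power2[OF mem] coeff
      by (rule suminf_le_if_circle_mean_le[OF fp circle_mean_compose_le[OF f]])
    ultimately show ?thesis
      using hardy_norm_nonneg[OF f] by (auto intro: power2_le_imp_le)
  qed
  then have "\<forall>f\<in>hardy2. hardy_norm (composition_op \<phi> f) \<le> 1 * hardy_norm f" by simp
  then show ?thesis
    unfolding hardy_bounded_linear_def
    by (intro conjI exI[of _ 1]) (use * in \<open>auto simp: composition_op_def fun_eq_iff\<close>)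
qed

end

subsection \<open>Linear fractional symbols fixing the origin\<close>


lemma hardy_inner_cmult_right:
  assumes "f \<in> hardy2" "h \<in> hardy2"
  shows "hardy_inner f (\<lambda>z. c * h z) = cnj c * hardy_inner f h"
  using hardy_inner_cnj[OF hardy2_cmult[OF assms(2)] assms(1), of c] hardy_inner_cnj[OF assms(2,1)]
    hardy_inner_cmult_left[OF assms(2,1), of c] by simp

text \<open>The adjoint of a dilation is identified with another dilation operator on
  \<open>hardy2\<close> only; this transfers boundedness across such a partial equality.\<close>

lemma hardy_bounded_linear_cong:
  assumes "hardy_bounded_linear T" "\<And>f. f \<in> hardy2 \<Longrightarrow> S f = T f"
  shows "hardy_bounded_linear S"
proof -
  obtain K where "\<And>f. f \<in> hardy2 \<Longrightarrow> hardy_norm (T f) \<le> K * hardy_norm f"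
    using assms(1) unfolding hardy_bounded_linear_def by blast
  then have "\<forall>f\<in>hardy2. hardy_norm (S f) \<le> K * hardy_norm f"
    using assms(2) by simp
  then show ?thesis
    unfolding hardy_bounded_linear_def
    using hardy_bounded_linearD[OF assms(1)] assms(2) hardy2_add hardy2_cmult
    by (intro conjI exI[of _ K]) auto
qed

lemma hardy_conj_in_hardy2:
  assumes "f \<in> hardy2"
  shows "hardy_conj f \<in> hardy2"
    and "taylor_coeff (hardy_conj f) n = cnj (taylor_coeff f n)"
proof -
  have s: "(\<lambda>n. cnj (taylor_coeff f n) * z ^ n) sums hardy_conj f z" if "norm z < 1" for z
  proof -
    have "(\<lambda>n. cnj (taylor_coeff f n * cnj z ^ n)) sums cnj (f (cnj z))"
      unfolding sums_cnj by (rule taylor_coeff_sums) (use hardy2D(1)[OF assms] that in auto)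
    then show ?thesis by (simp add: hardy_conj_def)
  qed
  have c: "taylor_coeff (hardy_conj f) = (\<lambda>n. cnj (taylor_coeff f n))"
    by (rule taylor_coeff_unique) (rule s)
  then show "taylor_coeff (hardy_conj f) n = cnj (taylor_coeff f n)" by simp
  have "hardy_conj f holomorphic_on ball 0 1"
    by (rule power_series_holomorphic_unit_ball) (rule s)
  then show "hardy_conj f \<in> hardy2"
    unfolding hardy2_iff c using hardy2D(2,3)[OF assms] by (auto simp: hardy_conj_def)
qed

lemma hardy_conj_conj: "hardy_conj (hardy_conj f) = f"
  by (simp add: hardy_conj_def)

lemma hardy_conj_cmult: "hardy_conj (\<lambda>z. c * f z) = (\<lambda>z. cnj c * hardy_conj f z)"
  by (simp add: hardy_conj_def)

text \<open>The coordinate function in the representation that vanishes off the disk; the plain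
  identity function is not in \<open>hardy2\<close>.\<close>

definition ident :: "complex \<Rightarrow> complex" where
  "ident = monomial_fun 1"

lemma ident_in_hardy2: "ident \<in> hardy2"
  by (simp add: ident_def monomial_fun_in_hardy2)

lemma taylor_coeff_ident: "taylor_coeff ident n = (if n = 1 then 1 else 0)"
  by (simp add: ident_def taylor_coeff_monomial_fun)

lemma ident_eq: "norm z < 1 \<Longrightarrow> ident z = z"
  using monomial_fun_eq[of z 1] by (simp add: ident_def)

lemma hardy_inner_ident: "f \<in> hardy2 \<Longrightarrow> hardy_inner f ident = taylor_coeff f (Suc 0)"
  using hardy_inner_monomial[of f 1] by (simp add: ident_def)

lemma hardy_conj_ident: "hardy_conj ident = ident"
  by (rule hardy2_eqI)
    (auto simp: hardy_conj_in_hardy2 ident_in_hardy2 taylor_coeff_ident)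

section \<open>Testing the operator identities on the function z\<close>

context disk_self_map
begin

abbreviation (input) C where "C \<equiv> composition_op \<phi>"

lemmas bounded = hardy_bounded_linear_composition_op

text \<open>The chain rule at the fixed point 0. In dual form it says that \<open>ident\<close> is
  an eigenvector of the adjoint.\<close>

lemma taylor_coeff_composition_op_1:
  assumes "f \<in> hardy2"
  shows "taylor_coeff (C f) (Suc 0) = deriv \<phi> 0 * taylor_coeff f (Suc 0)"
proof -
  have "taylor_coeff (C f) (Suc 0) = taylor_coeff (\<lambda>z. f (\<phi> z)) (Suc 0)"
  proof (rule arg_cong[where f = "\<lambda>g. g (Suc 0)"], rule taylor_coeff_cong)
    have "\<phi> ` ball 0 1 \<subseteq> ball 0 1" using norm_less_1 by auto
    from holomorphic_on_compose_gen[OF holomorphic hardy2D(1)[OF assms] this]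
    show "(\<lambda>z. f (\<phi> z)) holomorphic_on ball 0 1" by (simp add: o_def)
  qed (simp add: composition_op_def)
  moreover have "deriv (f \<circ> \<phi>) 0 = deriv f (\<phi> 0) * deriv \<phi> 0"
    using holomorphic hardy2D(1)[OF assms] zero
    by (intro deriv_chain) (auto simp: holomorphic_on_open field_differentiable_def)
  ultimately show ?thesis
    by (simp add: taylor_coeff_def o_def zero)
qed

text \<open>The scalar \<open>k\<close> is carried along so that the adjoint can be applied a second
  time to its own result.\<close>

lemma adjoint_ident:
  "hardy_adjoint C (\<lambda>z. k * ident z) = (\<lambda>z. k * cnj (deriv \<phi> 0) * ident z)"
  by (rule hardy_adjointI)
    (simp_all add: hardy2_cmult ident_in_hardy2 hardy_inner_cmult_right hardy_inner_ident
      taylor_coeff_composition_op_1 hardy_bounded_linearD(1)[OF bounded])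

lemma taylor_coeff_adjoint_1:
  assumes "g \<in> hardy2"
  shows "taylor_coeff (hardy_adjoint C g) (Suc 0) = cnj (hardy_inner (C ident) g)"
proof -
  note mem = hardy_adjoint_in_hardy2[OF bounded assms]
  have "hardy_inner (C ident) g = hardy_inner ident (hardy_adjoint C g)"
    by (rule hardy_inner_adjoint[OF bounded assms ident_in_hardy2])
  then show ?thesis
    using hardy_inner_cnj[OF ident_in_hardy2 mem] hardy_inner_ident[OF mem] by metis
qed

text \<open>Linear coefficients are compared on both sides of normality at \<open>ident\<close>: one
  order of the product gives the squared norm of \<open>C ident\<close>, the other gives
  \<open>cnj (deriv \<phi> 0) * deriv \<phi> 0\<close>.\<close>

lemma normal_ident:
  assumes "hardy_normal C"
  shows "hardy_inner (C ident) (C ident) = deriv \<phi> 0 * cnj (deriv \<phi> 0)"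
proof -
  note e = ident_in_hardy2
  note Ce = hardy_bounded_linearD(1)[OF bounded e]
  have "C (hardy_adjoint C ident) = hardy_adjoint C (C ident)"
    using assms e unfolding hardy_normal_def by blast
  moreover have "hardy_adjoint C ident = (\<lambda>z. cnj (deriv \<phi> 0) * ident z)"
    using adjoint_ident[of 1] by simp
  ultimately have "hardy_adjoint C (C ident) = (\<lambda>z. cnj (deriv \<phi> 0) * C ident z)"
    using hardy_bounded_linearD(3)[OF bounded e] by simp
  then have "cnj (hardy_inner (C ident) (C ident)) = cnj (deriv \<phi> 0) * (deriv \<phi> 0 * 1)"
    using taylor_coeff_adjoint_1[OF Ce] taylor_coeff_composition_op_1[OF e]
      taylor_coeff_cmult[OF hardy2D(1)[OF Ce]]
    by (simp add: taylor_coeff_ident)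
  from arg_cong[OF this, of cnj] show ?thesis by (simp add: mult.commute)
qed

text \<open>At \<open>ident\<close> the two outer terms of the identity have the same linear
  coefficient, the square of \<open>cnj (deriv \<phi> 0)\<close>. The middle term must therefore
  have it too, and its linear coefficient is a conjugated inner product.\<close>

lemma two_symmetric_ident:
  assumes "two_complex_symmetric_with hardy_conj C"
  shows "hardy_inner (C ident) (hardy_conj (C ident)) = (deriv \<phi> 0)\<^sup>2"
proof -
  note e = ident_in_hardy2
  let ?E = "C ident"
  let ?a = "deriv \<phi> 0"
  note Ce = hardy_bounded_linearD(1)[OF bounded e]
  note CCe = hardy_bounded_linearD(1)[OF bounded Ce]
  note JCe = hardy_conj_in_hardy2(1)[OF Ce]
  have adj: "hardy_adjoint C (hardy_adjoint C ident) = (\<lambda>z. (cnj ?a)\<^sup>2 * ident z)"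
    using adjoint_ident[of 1] adjoint_ident[of "cnj ?a"] by (simp add: power2_eq_square)
  note JCCe = hardy_conj_in_hardy2[OF CCe]
  let ?k = "\<lambda>z. hardy_conj (C ?E) z + (cnj ?a)\<^sup>2 * ident z"
  \<comment> \<open>The symmetry identity solved for its middle term.\<close>
  let ?h = "\<lambda>z. 1 / 2 * ?k z"
  have e2: "(\<lambda>z. (cnj ?a)\<^sup>2 * ident z) \<in> hardy2" by (rule hardy2_cmult[OF e])
  have k: "?k \<in> hardy2" by (rule hardy2_add[OF JCCe(1) e2])
  have h: "?h \<in> hardy2" by (rule hardy2_cmult[OF k])
  have "taylor_coeff (hardy_adjoint C (hardy_conj ?E)) = taylor_coeff ?h"
  proof (rule taylor_coeff_cong[OF hardy2D(1)[OF h]])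
    fix z :: complex assume "norm z < 1"
    then have "hardy_conj (C (C (hardy_conj ident))) z
        - 2 * hardy_adjoint C (hardy_conj (C (hardy_conj ident))) z
        + hardy_adjoint C (hardy_adjoint C ident) z = 0"
      using assms e unfolding two_complex_symmetric_with_def by auto
    then show "hardy_adjoint C (hardy_conj ?E) z = ?h z"
      unfolding hardy_conj_ident adj by (simp add: field_simps)
  qed
  moreover have "taylor_coeff ?h (Suc 0) = (cnj ?a)\<^sup>2"
    unfolding taylor_coeff_cmult[OF hardy2D(1)[OF k]] taylor_coeff_cmult[OF hardy2D(1)[OF e]]
      taylor_coeff_add[OF hardy2D(1)[OF JCCe(1)] hardy2D(1)[OF e2]]
    by (simp add: JCCe(2) taylor_coeff_composition_op_1 Ce e taylor_coeff_ident power2_eq_square)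
  ultimately have "cnj (hardy_inner ?E (hardy_conj ?E)) = (cnj ?a)\<^sup>2"
    using taylor_coeff_adjoint_1[OF JCe] by simp
  from arg_cong[OF this, of cnj] show ?thesis by simp
qed

text \<open>For the adjoint the roles are exchanged: the inner applications only scale
  \<open>ident\<close>, while the double adjoint is composition again. So the identity can be
  evaluated at every point instead of in one coefficient.\<close>

lemma adjoint_two_symmetric_ident:
  assumes "two_complex_symmetric_with hardy_conj (hardy_adjoint C)" and z: "norm z < 1"
  shows "(deriv \<phi> 0)\<^sup>2 * z - 2 * deriv \<phi> 0 * \<phi> z + \<phi> (\<phi> z) = 0"
proof -
  note e = ident_in_hardy2
  let ?a = "deriv \<phi> 0"
  note Ce = hardy_bounded_linearD(1)[OF bounded e]
  have 1: "hardy_adjoint C ident = (\<lambda>z. cnj ?a * ident z)"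
    using adjoint_ident[of 1] by simp
  have 2: "hardy_conj (hardy_adjoint C (hardy_adjoint C ident)) = (\<lambda>z. ?a\<^sup>2 * ident z)"
    unfolding 1 adjoint_ident hardy_conj_cmult hardy_conj_ident by (simp add: power2_eq_square)
  have 3: "hardy_adjoint (hardy_adjoint C) (hardy_conj (hardy_adjoint C ident)) = (\<lambda>z. ?a * C ident z)"
    unfolding 1 hardy_conj_cmult hardy_conj_ident
    by (simp add: hardy_adjoint_adjoint[OF bounded] hardy2_cmult e hardy_bounded_linearD(3)[OF bounded])
  have 4: "hardy_adjoint (hardy_adjoint C) (hardy_adjoint (hardy_adjoint C) ident) = C (C ident)"
    by (simp add: hardy_adjoint_adjoint[OF bounded] e Ce)
  have "hardy_conj (hardy_adjoint C (hardy_adjoint C (hardy_conj ident))) z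
      - 2 * hardy_adjoint (hardy_adjoint C) (hardy_conj (hardy_adjoint C (hardy_conj ident))) z
      + hardy_adjoint (hardy_adjoint C) (hardy_adjoint (hardy_adjoint C) ident) z = 0"
    using assms e unfolding two_complex_symmetric_with_def by auto
  then show ?thesis
    unfolding hardy_conj_ident 2 3 4 using z norm_less_1[of z] norm_less_1[of "\<phi> z"]
    by (simp add: composition_op_def ident_eq mult.assoc)
qed

end

section \<open>The normal form of a linear fractional map fixing 0\<close>

definition lin_frac :: "complex \<Rightarrow> complex \<Rightarrow> complex \<Rightarrow> complex" where
  "lin_frac a c z = a * z / (1 - c * z)"

lemma lin_frac_denominator:
  assumes "norm c < 1" "norm z < 1"
  shows "1 - c * z \<noteq> (0::complex)"
proof
  assume "1 - c * z = 0"
  then have "norm c * norm z = 1" by (metis eq_iff_diff_eq_0 norm_mult norm_one)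
  moreover have "norm c * norm z < 1 * 1"
    using assms by (intro mult_strict_mono') auto
  ultimately show False by simp
qed

lemma lin_frac_self_map:
  assumes "norm a + norm c \<le> 1" "norm c < 1"
  shows "disk_self_map (lin_frac a c)"
proof
  show "lin_frac a c holomorphic_on ball 0 1"
    unfolding lin_frac_def using lin_frac_denominator[OF assms(2)] by (auto intro!: holomorphic_intros)
  show "norm (lin_frac a c z) < 1" if z: "norm z < 1" for z
  proof -
    have "norm a * norm z \<le> (1 - norm c) * norm z"
      using assms by (intro mult_right_mono) auto
    also have "\<dots> < 1 - norm c * norm z"
      using z by (simp add: algebra_simps)
    also have "\<dots> \<le> norm (1 - c * z)"
      using norm_triangle_ineq2[of 1 "c * z"] by (simp add: norm_mult)
    finally show ?thesis
      using lin_frac_denominator[OF assms(2) z] by (simp add: lin_frac_def norm_mult norm_divide)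
  qed
qed (simp add: lin_frac_def)

lemma taylor_coeff_lin_frac:
  assumes "norm c < 1"
  shows "taylor_coeff (lin_frac a c) = (\<lambda>n. if n = 0 then 0 else a * c ^ (n - 1))"
proof (rule taylor_coeff_unique)
  fix z :: complex assume z: "norm z < 1"
  have "norm c * norm z < 1 * 1"
    using assms z by (intro mult_strict_mono') auto
  then have "(\<lambda>n. (c * z) ^ n) sums (1 / (1 - c * z))"
    by (intro geometric_sums) (simp add: norm_mult)
  then have "(\<lambda>n. a * z * (c * z) ^ n) sums (a * z * (1 / (1 - c * z)))"
    by (rule sums_mult)
  then have "(\<lambda>n. (if Suc n = 0 then 0 else a * c ^ (Suc n - 1)) * z ^ Suc n) sums lin_frac a c z"
    by (simp add: lin_frac_def power_mult_distrib mult_ac)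
  \<comment> \<open>The factor \<open>z\<close> shifts the geometric series by one. The case
    \<open>n = 0\<close> is separate because \<open>n - 1\<close> is truncated subtraction.\<close>
  then show "(\<lambda>n. (if n = 0 then 0 else a * c ^ (n - 1)) * z ^ n) sums lin_frac a c z"
    using sums_Suc[where f = "\<lambda>n. (if n = 0 then 0 else a * c ^ (n - 1)) * z ^ n"] by simp
qed

lemma deriv_lin_frac:
  assumes "norm c < 1"
  shows "deriv (lin_frac a c) 0 = a"
proof -
  have "taylor_coeff (lin_frac a c) 1 = a"
    by (simp add: taylor_coeff_lin_frac[OF assms])
  then show ?thesis by (simp add: taylor_coeff_def)
qed

lemma taylor_coeff_composition_lin_frac_ident:
  assumes "norm a + norm c \<le> 1" "norm c < 1"
  shows "taylor_coeff (composition_op (lin_frac a c) ident) = (\<lambda>n. if n = 0 then 0 else a * c ^ (n - 1))"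
proof -
  interpret disk_self_map "lin_frac a c" by (rule lin_frac_self_map[OF assms])
  have "taylor_coeff (composition_op (lin_frac a c) ident) = taylor_coeff (lin_frac a c)"
    by (rule taylor_coeff_cong[OF holomorphic])
      (simp add: composition_op_def norm_less_1 ident_eq)
  then show ?thesis by (simp add: taylor_coeff_lin_frac[OF assms(2)])
qed

text \<open>Stated for two functions because it is used with \<open>c' = c\<close> for normality,
  giving \<open>1 - c * cnj c\<close>, and with \<open>c' = cnj c\<close> for symmetry, giving
  \<open>1 - c * c\<close>.\<close>

lemma hardy_inner_coeff_geometric:
  assumes "f \<in> hardy2" "g \<in> hardy2" "norm c < 1" "norm c' < 1"
    and "taylor_coeff f = (\<lambda>n. if n = 0 then 0 else a * c ^ (n - 1))"
    and "taylor_coeff g = (\<lambda>n. if n = 0 then 0 else a' * c' ^ (n - 1))"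
  shows "hardy_inner f g = a * cnj a' / (1 - c * cnj c')"
proof -
  have "norm c * norm c' < 1 * 1"
    using assms by (intro mult_strict_mono') auto
  then have "(\<lambda>n. (c * cnj c') ^ n) sums (1 / (1 - c * cnj c'))"
    by (intro geometric_sums) (simp add: norm_mult)
  then have "(\<lambda>n. a * cnj a' * (c * cnj c') ^ n) sums (a * cnj a' * (1 / (1 - c * cnj c')))"
    by (rule sums_mult)
  then have "(\<lambda>n. taylor_coeff f (Suc n) * cnj (taylor_coeff g (Suc n))) sums (a * cnj a' / (1 - c * cnj c'))"
    by (simp add: assms(5,6) power_mult_distrib mult_ac)
  then have "(\<lambda>n. taylor_coeff f n * cnj (taylor_coeff g n)) sums (a * cnj a' / (1 - c * cnj c'))"
    using sums_Suc[where f = "\<lambda>n. taylor_coeff f n * cnj (taylor_coeff g n)"] by (simp add: assms(5,6))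
  from sums_unique2[OF hardy_inner_sums[OF assms(1,2)] this] show ?thesis .
qed

section \<open>Dilations: the case c = 0\<close>

lemma lin_frac_zero: "lin_frac a 0 = (*) a"
  by (simp add: lin_frac_def fun_eq_iff)

lemma dilation_self_map: "norm a \<le> 1 \<Longrightarrow> disk_self_map ((*) a)"
  using lin_frac_self_map[of a 0] by (simp add: lin_frac_zero)

lemma taylor_coeff_dilation:
  assumes "norm a \<le> 1" "f \<in> hardy2"
  shows "taylor_coeff (composition_op ((*) a) f) n = a ^ n * taylor_coeff f n"
proof -
  interpret disk_self_map "(*) a" by (rule dilation_self_map[OF assms(1)])
  have "taylor_coeff (composition_op ((*) a) f) = (\<lambda>n. a ^ n * taylor_coeff f n)"
  proof (rule taylor_coeff_unique)
    fix z :: complex assume "norm z < 1"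
    moreover have eq: "a ^ n * taylor_coeff f n * z ^ n = taylor_coeff f n * (a * z) ^ n" for n
      by (simp add: power_mult_distrib)
    ultimately show "(\<lambda>n. a ^ n * taylor_coeff f n * z ^ n) sums composition_op ((*) a) f z"
      unfolding eq using taylor_coeff_sums[OF hardy2D(1)[OF assms(2)] norm_less_1]
      by (simp add: composition_op_def)
  qed
  then show ?thesis by simp
qed

text \<open>A dilation is diagonal in the monomials with entries \<open>a ^ n\<close>, so moving it
  across the inner product conjugates the entries.\<close>

lemma hardy_inner_dilation:
  assumes "norm a \<le> 1" "f \<in> hardy2" "g \<in> hardy2"
  shows "hardy_inner (composition_op ((*) a) f) g = hardy_inner f (composition_op ((*) (cnj a)) g)"
proof -
  have a: "norm (cnj a) \<le> 1" using assms by simp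
  note m1 = hardy_bounded_linearD(1)[OF disk_self_map.bounded[OF dilation_self_map[OF assms(1)]] assms(2)]
  note m2 = hardy_bounded_linearD(1)[OF disk_self_map.bounded[OF dilation_self_map[OF a]] assms(3)]
  show ?thesis
    using hardy_inner_sums[OF m1 assms(3)] hardy_inner_sums[OF assms(2) m2]
    unfolding taylor_coeff_dilation[OF assms(1,2)] taylor_coeff_dilation[OF a assms(3)]
    by (simp add: mult_ac sums_iff)
qed

lemma composition_op_compose:
  assumes "\<And>z. norm z < 1 \<Longrightarrow> norm (\<phi> z) < 1"
  shows "composition_op \<phi> (composition_op \<psi> f) = composition_op (\<lambda>z. \<psi> (\<phi> z)) f"
  using assms by (auto simp: composition_op_def fun_eq_iff)

lemma hardy_conj_dilation:
  "hardy_conj (composition_op ((*) a) f) = composition_op ((*) (cnj a)) (hardy_conj f)"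
  by (auto simp: hardy_conj_def composition_op_def fun_eq_iff)

context
  fixes a :: complex
  assumes a: "norm a \<le> 1"
begin

lemma dilation_in_hardy2: "f \<in> hardy2 \<Longrightarrow> composition_op ((*) a) f \<in> hardy2"
  by (rule hardy_bounded_linearD(1)[OF disk_self_map.bounded[OF dilation_self_map[OF a]]])

lemma adjoint_dilation:
  assumes "f \<in> hardy2"
  shows "hardy_adjoint (composition_op ((*) a)) f = composition_op ((*) (cnj a)) f"
proof (rule hardy_adjointI)
  show "composition_op ((*) (cnj a)) f \<in> hardy2"
    by (rule hardy_bounded_linearD(1)[OF disk_self_map.bounded[OF dilation_self_map] assms]) (use a in simp)
qed (rule hardy_inner_dilation[OF a _ assms])

lemma adjoint_dilation_in_hardy2: "f \<in> hardy2 \<Longrightarrow> composition_op ((*) (cnj a)) f \<in> hardy2"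
  by (rule hardy_bounded_linearD(1)[OF disk_self_map.bounded[OF dilation_self_map]]) (use a in auto)

lemma dilation_normal: "hardy_normal (composition_op ((*) a))"
  unfolding hardy_normal_def
proof (intro conjI ballI)
  show "hardy_bounded_linear (composition_op ((*) a))"
    by (rule disk_self_map.bounded[OF dilation_self_map[OF a]])
  fix f assume f: "f \<in> hardy2"
  \<comment> \<open>Composition operators cut off outside the disk, so merging two of them requires
    the inner dilation to stay inside. Both products then become composition with
    \<open>a * cnj a * z\<close>.\<close>
  have "norm (a * z) < 1 \<and> norm (cnj a * z) < 1" if "norm z < 1" for z
    using that mult_left_le_one_le[of "norm z" "norm a"] a by (simp add: norm_mult)
  then show "composition_op ((*) a) (hardy_adjoint (composition_op ((*) a)) f) =
      hardy_adjoint (composition_op ((*) a)) (composition_op ((*) a) f)"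
    by (simp add: adjoint_dilation f dilation_in_hardy2 composition_op_compose mult.left_commute)
qed

text \<open>Conjugating a dilation operator by \<open>hardy_conj\<close> already gives its adjoint.
  All three terms are thus the squared adjoint, with weights 1, -2 and 1.\<close>

lemma dilation_two_symmetric: "two_complex_symmetric_with hardy_conj (composition_op ((*) a))"
  unfolding two_complex_symmetric_with_def
  by (simp add: disk_self_map.bounded[OF dilation_self_map[OF a]] hardy_conj_dilation hardy_conj_conj
      adjoint_dilation adjoint_dilation_in_hardy2)

lemma adjoint_dilation_two_symmetric:
  "two_complex_symmetric_with hardy_conj (hardy_adjoint (composition_op ((*) a)))"
  unfolding two_complex_symmetric_with_def
proof (intro conjI ballI)
  show "hardy_bounded_linear (hardy_adjoint (composition_op ((*) a)))"
    by (rule hardy_bounded_linear_cong[OF disk_self_map.bounded[OF dilation_self_map] adjoint_dilation])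
      (use a in auto)
qed (simp add: disk_self_map.bounded[OF dilation_self_map[OF a]] hardy_adjoint_adjoint
    hardy_conj_dilation hardy_conj_conj adjoint_dilation adjoint_dilation_in_hardy2 dilation_in_hardy2
    hardy_conj_in_hardy2)

end

lemma divide_one_minus_eq_self:
  assumes "x / (1 - y) = x" "x \<noteq> (0::complex)"
  shows "y = 0"
  \<comment> \<open>For \<open>y = 1\<close> the quotient is 0 in HOL, which contradicts
    \<open>x \<noteq> 0\<close>.\<close>
  using assms by (cases "y = 1") (auto simp: field_simps)

section \<open>Each of the three properties forces c = 0\<close>

locale lin_frac_self_map =
  fixes a c :: complex
  assumes nonzero: "a \<noteq> 0" and norm_sum: "norm a + norm c \<le> 1"
begin

lemma norm_c: "norm c < 1"
  using nonzero norm_sum by (metis add_le_same_cancel2 linorder_not_le order_less_le_trans zero_less_norm_iff)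

sublocale disk_self_map "lin_frac a c"
  by (rule lin_frac_self_map[OF norm_sum norm_c])

lemma composition_ident_in_hardy2: "C ident \<in> hardy2"
  by (rule hardy_bounded_linearD(1)[OF bounded ident_in_hardy2])

lemma taylor_coeff_composition_ident:
  "taylor_coeff (C ident) = (\<lambda>n. if n = 0 then 0 else a * c ^ (n - 1))"
  by (rule taylor_coeff_composition_lin_frac_ident[OF norm_sum norm_c])

lemma normal_imp_zero:
  assumes "hardy_normal C"
  shows "c = 0"
proof -
  have "a * cnj a / (1 - c * cnj c) = a * cnj a"
    using normal_ident[OF assms] hardy_inner_coeff_geometric[OF composition_ident_in_hardy2
        composition_ident_in_hardy2 norm_c norm_c taylor_coeff_composition_ident taylor_coeff_composition_ident]
    by (simp add: deriv_lin_frac[OF norm_c])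
  from divide_one_minus_eq_self[OF this] show ?thesis using nonzero by simp
qed

lemma two_symmetric_imp_zero:
  assumes "two_complex_symmetric_with hardy_conj C"
  shows "c = 0"
proof -
  have "taylor_coeff (hardy_conj (C ident)) = (\<lambda>n. if n = 0 then 0 else cnj a * cnj c ^ (n - 1))"
    by (rule ext) (simp add: hardy_conj_in_hardy2(2)[OF composition_ident_in_hardy2] taylor_coeff_composition_ident)
  from hardy_inner_coeff_geometric[OF composition_ident_in_hardy2
      hardy_conj_in_hardy2(1)[OF composition_ident_in_hardy2] norm_c _ taylor_coeff_composition_ident this]
  have "a\<^sup>2 / (1 - c * c) = a\<^sup>2"
    using two_symmetric_ident[OF assms] norm_c by (simp add: deriv_lin_frac[OF norm_c] power2_eq_square)
  from divide_one_minus_eq_self[OF this] show ?thesis using nonzero by simp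
qed

text \<open>Clearing denominators in the functional equation and cancelling \<open>c * z\<close>
  leaves an affine function of \<open>z\<close> that vanishes on the punctured disk. Its constant
  term gives \<open>a = 1\<close>, and then the bound on the norms leaves no room for
  \<open>c\<close>.\<close>

lemma adjoint_two_symmetric_imp_zero:
  assumes "two_complex_symmetric_with hardy_conj (hardy_adjoint C)"
  shows "c = 0"
proof (rule ccontr)
  assume c: "c \<noteq> 0"
  have *: "a - 1 + c * (1 + a) * z = 0" if z: "norm z < 1" "z \<noteq> 0" for z
  proof -
    define u where "u = 1 - c * z"
    \<comment> \<open>The denominator of the second iterate, which equals
      \<open>a\<^sup>2 * z / v\<close>.\<close>
    define v where "v = u - c * (a * z)"
    have u: "u \<noteq> 0" unfolding u_def by (rule lin_frac_denominator[OF norm_c z(1)])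
    have v: "v = u * (1 - c * lin_frac a c z)"
      unfolding v_def lin_frac_def u_def[symmetric] using u by (simp add: field_simps)
    have v0: "v \<noteq> 0"
      unfolding v using u lin_frac_denominator[OF norm_c norm_less_1[OF z(1)]] by simp
    have "lin_frac a c (lin_frac a c z) = a * lin_frac a c z / (v / u)"
      using u unfolding v lin_frac_def[of a c "lin_frac a c z"] by simp
    also have "\<dots> = a\<^sup>2 * z / v"
      unfolding lin_frac_def u_def[symmetric] using u by (simp add: power2_eq_square)
    finally have "a\<^sup>2 * z - 2 * a * (a * z / u) + a\<^sup>2 * z / v = 0"
      using adjoint_two_symmetric_ident[OF assms z(1)]
      by (simp add: deriv_lin_frac[OF norm_c] lin_frac_def[of a c z] u_def)
    then have "a\<^sup>2 * z * (1 - 2 / u + 1 / v) = 0"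
      by (simp add: algebra_simps power2_eq_square)
    then have "1 - 2 / u + 1 / v = 0" using nonzero z by simp
    then have "u * v - 2 * v + u = 0" using u v0 by (simp add: field_simps)
    moreover have "u * v - 2 * v + u = c * z * (a - 1 + c * (1 + a) * z)"
      unfolding v_def u_def by algebra
    ultimately show ?thesis using c z by simp
  qed
  have "2 * (a - 1) = (a - 1 + c * (1 + a) * (1 / 2)) + (a - 1 + c * (1 + a) * (- 1 / 2))"
    by (simp add: algebra_simps)
  also have "\<dots> = 0" using *[of "1 / 2"] *[of "- 1 / 2"] by simp
  finally have "a = 1" by simp
  with norm_sum c show False by simp
qed

lemma symmetric_iff_normal:
  "two_complex_symmetric_with hardy_conj C \<longleftrightarrow> hardy_normal C"
  "two_complex_symmetric_with hardy_conj (hardy_adjoint C) \<longleftrightarrow> hardy_normal C"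
proof -
  have "hardy_normal C \<and> two_complex_symmetric_with hardy_conj C \<and>
      two_complex_symmetric_with hardy_conj (hardy_adjoint C)" if "c = 0"
    using dilation_normal dilation_two_symmetric adjoint_dilation_two_symmetric norm_sum that
    by (simp add: lin_frac_zero)
  then show "two_complex_symmetric_with hardy_conj C \<longleftrightarrow> hardy_normal C"
    "two_complex_symmetric_with hardy_conj (hardy_adjoint C) \<longleftrightarrow> hardy_normal C"
    using normal_imp_zero two_symmetric_imp_zero adjoint_two_symmetric_imp_zero by blast+
qed

end

text \<open>At a zero of the denominator HOL evaluates the quotient to 0, so the self-map hypothesis
  alone does not rule out a pole there. The conclusion on the closed disk is needed because the
  sharp bound on the parameters is read off on the unit circle.\<close>

lemma mobius_self_map_bound:
  fixes a b c d z :: complex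
  assumes "a * d - b * c \<noteq> 0" "\<And>z. norm z < 1 \<Longrightarrow> norm ((a * z + b) / (c * z + d)) < 1" "norm z \<le> 1"
  shows "norm (a * z + b) \<le> norm (c * z + d)" "c * z + d \<noteq> 0"
proof -
  let ?S = "ball 0 1 - {- d / c}"
  \<comment> \<open>By density the bound extends to the closed disk and to a possible pole, where the
    numerator would vanish too. If \<open>c = 0\<close> then \<open>- d / c = 0\<close>, and removing it does no harm.\<close>
  have "z islimpt ball 0 1" using assms(3) by (simp add: islimpt_ball)
  then have "z islimpt insert (- d / c) ?S" by (simp add: islimpt_insert)
  then have cl: "z \<in> closure ?S" unfolding islimpt_insert by (simp add: closure_def)
  have "norm (a * z + b) - norm (c * z + d) \<le> 0"
  proof (rule continuous_le_on_closure[OF _ cl])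
    show "norm (a * w + b) - norm (c * w + d) \<le> 0" if "w \<in> ?S" for w
    proof -
      have "c * w + d \<noteq> 0"
      proof
        assume 0: "c * w + d = 0"
        show False
        proof (cases "c = 0")
          case True
          then show ?thesis using 0 assms(1) by simp
        next
          case False
          then have "w = - d / c" using 0 by (simp add: field_simps eq_neg_iff_add_eq_0)
          then show ?thesis using that by simp
        qed
      qed
      then show ?thesis using assms(2)[of w] that by (simp add: norm_divide)
    qed
  qed (intro continuous_intros)
  then show le: "norm (a * z + b) \<le> norm (c * z + d)" by simp
  show "c * z + d \<noteq> 0"
  proof
    assume 0: "c * z + d = 0"
    with le have 1: "a * z + b = 0" by simp
    \<comment> \<open>The determinant is a combination of numerator and denominator, so the two have
      no common zero.\<close>
    have "a * d - b * c = a * (c * z + d) - c * (a * z + b)" by (simp add: algebra_simps)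
    with 0 1 assms(1) show False by simp
  qed
qed

theorem theorem2:
  fixes a b c d :: complex and \<phi> :: "complex \<Rightarrow> complex"
  assumes "\<phi> = (\<lambda>z. (a * z + b) / (c * z + d))"
    and "a * d - b * c \<noteq> 0"
    and "\<phi> holomorphic_on ball 0 1"
    and "\<phi> ` ball 0 1 \<subseteq> ball 0 1"
    and "\<phi> 0 = 0"
  shows "(two_complex_symmetric_with hardy_conj (composition_op \<phi>) \<longleftrightarrow>
            hardy_normal (composition_op \<phi>)) \<and>
         (two_complex_symmetric_with hardy_conj (hardy_adjoint (composition_op \<phi>)) \<longleftrightarrow>
            hardy_normal (composition_op \<phi>))"
proof -
  have self: "norm ((a * z + b) / (c * z + d)) < 1" if "norm z < 1" for z
    using assms(1,4) that by (auto simp: image_subset_iff)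
  have bound: "norm (a * z + b) \<le> norm (c * z + d)" "c * z + d \<noteq> 0" if "norm z \<le> 1" for z
    by (rule mobius_self_map_bound[OF assms(2) _ that], erule self)+
  have d: "d \<noteq> 0" using bound(2)[of 0] by simp
  have b: "b = 0" using assms(1,5) d by simp
  have a: "a \<noteq> 0" using assms(2) b by auto
  define a' c' where "a' = a / d" and "c' = - c / d"
  have phi: "\<phi> = lin_frac a' c'"
  proof
    fix z
    have "1 - c' * z = (c * z + d) / d" using d by (simp add: c'_def field_simps)
    then show "\<phi> z = lin_frac a' c' z"
      using d by (simp add: assms(1) b lin_frac_def a'_def)
  qed
  have bound': "norm (a' * z) \<le> norm (1 - c' * z)" "1 - c' * z \<noteq> 0" if "norm z \<le> 1" for z
  proof -
    have eq: "1 - c' * z = (c * z + d) / d" "a' * z = (a * z + b) / d"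
      using d b by (simp_all add: a'_def c'_def field_simps)
    show "norm (a' * z) \<le> norm (1 - c' * z)" "1 - c' * z \<noteq> 0"
      unfolding eq norm_divide using bound[OF that] d by (auto intro: divide_right_mono)
  qed
  have c': "norm c' < 1"
  proof (rule ccontr)
    assume "\<not> norm c' < 1"
    \<comment> \<open>Otherwise the pole \<open>1 / c'\<close> would lie in the closed disk.\<close>
    then have "norm (1 / c') \<le> 1" "c' \<noteq> 0" by (auto simp: norm_divide divide_le_eq_1 not_less)
    then show False using bound'(2)[of "1 / c'"] by simp
  qed
  have "norm a' + norm c' \<le> 1"
  proof (cases "c' = 0")
    case True
    then show ?thesis using bound'(1)[of 1] by simp
  next
    case False
    \<comment> \<open>The unimodular point that makes \<open>c' * z\<close> equal to |c'|. There the
      denominator is smallest on the circle, so the bound is sharpest.\<close>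
    define z where "z = cnj c' / of_real (norm c')"
    have z: "norm z = 1" using False by (simp add: z_def norm_divide)
    have "c' * z = of_real ((norm c')\<^sup>2) / of_real (norm c')"
      unfolding complex_norm_square z_def by simp
    also have "\<dots> = of_real (norm c')" using False by (simp add: power2_eq_square)
    finally have "1 - c' * z = of_real (1 - norm c')" by simp
    then have "norm a' \<le> \<bar>1 - norm c'\<bar>"
      using bound'(1)[of z] z by (simp only: norm_mult norm_of_real) simp
    then show ?thesis using c' by simp
  qed
  then interpret lin_frac_self_map a' c'
    by unfold_locales (use a d in \<open>auto simp: a'_def\<close>)
  show ?thesis using symmetric_iff_normal unfolding phi by blast
qed

end
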